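(* Every non-universal $\equiv_{\mathcal{I}}$-degree $R$ has infinitely many pairwise $\leq_{\mathcal{I}}$-incomparable strong minimal covers in the $\equiv_{\mathcal{I}}$-degrees, each given by a self-full ceer. Moreover, if $R$ is dark, then it has infinitely many pairwise $\leq_{\mathcal{I}}$-incomparable dark strong minimal covers in the $\equiv_{\mathcal{I}}$-degrees.
   Context: A ceer is a computably enumerable equivalence relation on $\omega$. For equivalence relations $E,R$ on $\omega$, $E\leq R$ means there is a computable $f$ with $x\mathrel{E}y\iff f(x)\mathrel{R}f(y)$ for all $x,y$. A ceer is universal if every ceer is $\leq$ it. $\mathrm{Id}$ is equality on $\omega$ and, for $n\geq1$, $\mathrm{Id}_n$ is congruence modulo $n$. The uniform join $E\oplus R$ is defined by $2u\mathrel{(E\oplus R)}2v\iff u\mathrel{E}v$, $2u+1\mathrel{(E\oplus R)}2v+1\iff u\mathrel{R}v$, and no even number equivalent to an odd one. Define $A\leq_{\mathcal{I}}B$ iff $A\leq B$ or $A\leq B\oplus\mathrm{Id}_n$ for some $n\geq1$; $\equiv_{\mathcal{I}}$ is the induced equivalence, and the $\equiv_{\mathcal{I}}$-degrees are ordered by $\leq_{\mathcal{I}}$ (an $\equiv_{\mathcal{I}}$-degree is universal iff it contains a universal ceer). In a preorder, $y$ is a strong minimal cover of $x$ if $x<y$ and every $z<y$ satisfies $z\leq x$. A ceer is dark if it has infinitely many classes and $\mathrm{Id}\not\leq$ it. A ceer $E$ is self-full if for every computable $g$ reducing $E$ to $E$ and every $j$ there is $k$ with $g(k)\mathrel{E}j$.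 *)

theory Defs
  imports "HOL-Library.Nat_Bijection" "HOL-Number_Theory.Cong"
begin

text \<open>
  Kleene's partial recursive functions, presented on unary functions: several arguments are passed
  through the Cantor pairing \<^const>\<open>prod_encode\<close>, which replaces the projection functions and the
  arities of the textbook definition.
\<close>

text \<open>The least zero of \<open>g\<close>, undefined if the search meets an undefined value first.\<close>

definition mu_least :: "(nat \<rightharpoonup> nat) \<Rightarrow> nat option" where
  "mu_least g =
     (if \<exists>n. g n = Some 0 \<and> (\<forall>m<n. g m \<noteq> None) then Some (LEAST n. g n = Some 0) else None)"

primrec prim_iter :: "nat option \<Rightarrow> (nat \<Rightarrow> nat \<rightharpoonup> nat) \<Rightarrow> nat \<Rightarrow> nat option" where
  "prim_iter b s 0 = b"
| "prim_iter b s (Suc m) = Option.bind (prim_iter b s m) (s m)"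

inductive partial_recursive :: "(nat \<rightharpoonup> nat) \<Rightarrow> bool" where
  zero: "partial_recursive (\<lambda>x. Some 0)"
| succ: "partial_recursive (\<lambda>x. Some (Suc x))"
| proj1: "partial_recursive (\<lambda>x. Some (fst (prod_decode x)))"
| proj2: "partial_recursive (\<lambda>x. Some (snd (prod_decode x)))"
| pair: "partial_recursive f \<Longrightarrow> partial_recursive g \<Longrightarrow>
    partial_recursive
      (\<lambda>x. Option.bind (f x) (\<lambda>a. Option.bind (g x) (\<lambda>b. Some (prod_encode (a, b)))))"
| comp: "partial_recursive f \<Longrightarrow> partial_recursive g \<Longrightarrow>
    partial_recursive (\<lambda>x. Option.bind (g x) f)"
| prim_rec: "partial_recursive f \<Longrightarrow> partial_recursive g \<Longrightarrow>
    partial_recursive (\<lambda>x. case prod_decode x of (a, n) \<Rightarrow>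
      prim_iter (f a) (\<lambda>m r. g (prod_encode (a, prod_encode (m, r)))) n)"
| mu: "partial_recursive f \<Longrightarrow>
    partial_recursive (\<lambda>a. mu_least (\<lambda>n. f (prod_encode (a, n))))"

definition computable :: "(nat \<Rightarrow> nat) \<Rightarrow> bool" where
  "computable f \<longleftrightarrow> partial_recursive (\<lambda>x. Some (f x))"

definition ce_set :: "nat set \<Rightarrow> bool" where
  "ce_set A \<longleftrightarrow> (\<exists>f. partial_recursive f \<and> A = dom f)"

definition ceer :: "nat rel \<Rightarrow> bool" where
  "ceer E \<longleftrightarrow> equiv UNIV E \<and> ce_set (prod_encode ` E)"

definition reduction :: "(nat \<Rightarrow> nat) \<Rightarrow> nat rel \<Rightarrow> nat rel \<Rightarrow> bool" where
  "reduction f E R \<longleftrightarrow> computable f \<and> (\<forall>x y. (x, y) \<in> E \<longleftrightarrow> (f x, f y) \<in> R)"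

definition reducible :: "nat rel \<Rightarrow> nat rel \<Rightarrow> bool"  (infix \<open>\<le>\<^sub>c\<close> 50) where
  "E \<le>\<^sub>c R \<longleftrightarrow> (\<exists>f. reduction f E R)"

definition universal_ceer :: "nat rel \<Rightarrow> bool" where
  "universal_ceer U \<longleftrightarrow> ceer U \<and> (\<forall>E. ceer E \<longrightarrow> E \<le>\<^sub>c U)"

definition dark_ceer :: "nat rel \<Rightarrow> bool" where
  "dark_ceer E \<longleftrightarrow> ceer E \<and> infinite (UNIV // E) \<and> \<not> Id \<le>\<^sub>c E"

definition self_full_ceer :: "nat rel \<Rightarrow> bool" where
  "self_full_ceer E \<longleftrightarrow> ceer E \<and> (\<forall>g. reduction g E E \<longrightarrow> (\<forall>j. \<exists>k. (g k, j) \<in> E))"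

definition Id_mod :: "nat \<Rightarrow> nat rel" where
  "Id_mod n = {(x, y). [x = y] (mod n)}"

definition uniform_join :: "nat rel \<Rightarrow> nat rel \<Rightarrow> nat rel"  (infixl \<open>\<oplus>\<close> 65) where
  "E \<oplus> R = {(2 * u, 2 * v) | u v. (u, v) \<in> E} \<union> {(2 * u + 1, 2 * v + 1) | u v. (u, v) \<in> R}"

definition reducible_I :: "nat rel \<Rightarrow> nat rel \<Rightarrow> bool"  (infix \<open>\<le>\<^sub>I\<close> 50) where
  "A \<le>\<^sub>I B \<longleftrightarrow> A \<le>\<^sub>c B \<or> (\<exists>n\<ge>1. A \<le>\<^sub>c B \<oplus> Id_mod n)"

definition equiv_I :: "nat rel rel" where
  "equiv_I = {(A, B). ceer A \<and> ceer B \<and> A \<le>\<^sub>I B \<and> B \<le>\<^sub>I A}"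

definition I_degrees :: "nat rel set set" where
  "I_degrees = {E. ceer E} // equiv_I"

text \<open>
  As \<open>\<le>\<^sub>I\<close> is a preorder, the choice of representatives is immaterial.
\<close>

definition deg_le :: "nat rel set \<Rightarrow> nat rel set \<Rightarrow> bool"  (infix \<open>\<sqsubseteq>\<^sub>I\<close> 50) where
  "a \<sqsubseteq>\<^sub>I b \<longleftrightarrow> (\<exists>A\<in>a. \<exists>B\<in>b. A \<le>\<^sub>I B)"

definition given_by :: "(nat rel \<Rightarrow> bool) \<Rightarrow> nat rel set \<Rightarrow> bool" where
  "given_by P d \<longleftrightarrow> (\<exists>E\<in>d. P E)"

definition strong_minimal_cover ::
    "'a set \<Rightarrow> ('a \<Rightarrow> 'a \<Rightarrow> bool) \<Rightarrow> 'a \<Rightarrow> 'a \<Rightarrow> bool" where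
  "strong_minimal_cover D le x y \<longleftrightarrow>
     x \<in> D \<and> y \<in> D \<and> le x y \<and> \<not> le y x \<and> (\<forall>z\<in>D. le z y \<and> \<not> le y z \<longrightarrow> le z x)"

end

theory Submission imports Defs begin

text \<open>
  Fix \<open>R\<close> in the given degree. A finite injury construction produces a ceer \<open>E\<close> that restricts to
  \<open>R\<close> on the even numbers and has the following property: every c.e. set either meets all
  \<open>E\<close>-classes, or is covered by the classes of even numbers and finitely many others. A ceer below
  \<open>E\<close> is, up to equivalence, the restriction of \<open>E\<close> to a c.e. set; hence it either bounds \<open>E\<close> or is
  below \<open>R \<oplus> Id_mod n\<close> for some \<open>n\<close>. So \<open>E\<close> gives a strong minimal cover as soon as \<open>E\<close> is not below
  \<open>R\<close>, and it is then self-full, not universal, and dark if \<open>R\<close> is. Two such covers are equivalent or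
  incomparable, so it suffices to avoid finitely many earlier covers, too.

  To keep \<open>E\<close> from reducing to a ceer \<open>Q\<close> that is not universal, one copies a universal ceer \<open>U\<close> to
  odd markers, adding a marker whenever the given program looks like a reduction of \<open>E\<close> to \<open>Q\<close> on
  the present ones; infinitely many markers would reduce \<open>U\<close> to \<open>Q\<close>. To make a c.e. set meet the
  class of \<open>j\<close>, one merges with \<open>j\<close> the class of one of its elements that contains neither an even
  number nor a marker of higher priority.
\<close>

section \<open>Effective functions on encodable types\<close>

text \<open>The two kinds of requirement pull in opposite directions: meeting every class wants
  merges, irreducibility wants odd classes kept apart. They coexist because a c.e. set needs a
  single merge to meet the class of \<open>j\<close>, so each such requirement acts once, and
  because a requirement against a reduction keeps only finitely many markers in the limit. These
  limit markers must be spared by lower requirements; they account for the finitely many exceptional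
  classes, which some \<open>Id_mod n\<close> absorbs. The relations to be avoided are all
  \<open>A \<oplus> Id_mod n\<close> with \<open>A\<close> equal to \<open>R\<close> or to an
  earlier cover, because \<open>E \<le>\<^sub>I A\<close> means a reduction to one of them. None of
  them bounds \<open>U\<close>: for \<open>R\<close> this is the hypothesis, and for an earlier
  cover \<open>F\<close> it holds because \<open>F \<oplus> F\<close> does not reduce to
  \<open>F \<oplus> Id_mod n\<close>.\<close>

class enc =
  fixes enc :: "'a \<Rightarrow> nat"
  assumes inj_enc: "inj enc"

lemma enc_eq_iff [simp]: "enc x = enc y \<longleftrightarrow> x = y"
  by (rule inj_eq [OF inj_enc])

instantiation nat :: enc
begin
definition enc_nat :: "nat \<Rightarrow> nat" where [simp]: "enc_nat n = n"
instance by standard (simp add: inj_def)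
end

instantiation bool :: enc
begin
definition enc_bool :: "bool \<Rightarrow> nat" where "enc_bool b = of_bool b"
instance by standard (simp add: inj_def enc_bool_def)
end

instantiation prod :: (enc, enc) enc
begin
definition enc_prod :: "'a \<times> 'b \<Rightarrow> nat" where "enc_prod p = prod_encode (enc (fst p), enc (snd p))"
instance by standard (auto simp: inj_def enc_prod_def prod_eq_iff)
end

instantiation list :: (enc) enc
begin
definition enc_list :: "'a list \<Rightarrow> nat" where "enc_list xs = list_encode (map enc xs)"
instance
  by standard (auto simp: inj_def enc_list_def list_encode_eq inj_map_eq_map [OF inj_enc])
end

lemma enc_Pair: "enc (a, b) = prod_encode (enc a, enc b)"
  by (simp add: enc_prod_def)

lemma enc_Nil [simp]: "enc [] = 0"
  and enc_Cons [simp]: "enc (x # xs) = Suc (prod_encode (enc x, enc xs))"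
  by (simp_all add: enc_list_def)

lemma computable_comp:
  assumes "computable f" "computable g"
  shows "computable (\<lambda>x. f (g x))"
  using partial_recursive.comp [of "\<lambda>x. Some (f x)" "\<lambda>x. Some (g x)"] assms
  by (simp add: computable_def)

lemma computable_pair:
  assumes "computable f" "computable g"
  shows "computable (\<lambda>x. prod_encode (f x, g x))"
  using partial_recursive.pair [of "\<lambda>x. Some (f x)" "\<lambda>x. Some (g x)"] assms
  by (simp add: computable_def)

lemma computable_fst: "computable (\<lambda>x. fst (prod_decode x))"
  and computable_snd: "computable (\<lambda>x. snd (prod_decode x))"
  and computable_Suc: "computable Suc"
  by (simp_all add: computable_def partial_recursive.intros)

lemma computable_const: "computable (\<lambda>x. c)"
proof (induction c)
  case 0
  show ?case by (simp add: computable_def partial_recursive.zero)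
next
  case (Suc c)
  show ?case using computable_comp [OF computable_Suc Suc] by simp
qed

lemma computable_ident: "computable (\<lambda>x. x)"
  using computable_pair [OF computable_fst computable_snd] by simp

lemma computable_rec_nat:
  assumes "computable f" "computable g"
  shows "computable (\<lambda>x. rec_nat (f (fst (prod_decode x)))
    (\<lambda>m r. g (prod_encode (fst (prod_decode x), prod_encode (m, r)))) (snd (prod_decode x)))"
proof -
  have "prim_iter (Some b) (\<lambda>m r. Some (s m r)) n = Some (rec_nat b s n)" for b s n
    by (induction n) simp_all
  then show ?thesis
    using partial_recursive.prim_rec [of "\<lambda>x. Some (f x)" "\<lambda>x. Some (g x)"] assms
    by (simp add: computable_def case_prod_beta)
qed

text \<open>A witness \<open>g\<close> is only constrained on codes; the encodings need not be surjective.\<close>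

definition effective :: "('a::enc \<Rightarrow> 'b::enc) \<Rightarrow> bool" where
  "effective f \<longleftrightarrow> (\<exists>g. computable g \<and> (\<forall>x. g (enc x) = enc (f x)))"

lemma effectiveI: "computable g \<Longrightarrow> (\<And>x. g (enc x) = enc (f x)) \<Longrightarrow> effective f"
  by (auto simp: effective_def)

lemma effective_nat_iff: "effective f \<longleftrightarrow> computable f" for f :: "nat \<Rightarrow> nat"
proof -
  have "g = f" if "\<forall>x. g x = f x" for g :: "nat \<Rightarrow> nat" using that by blast
  then show ?thesis by (auto simp: effective_def)
qed

text \<open>The rules follow the syntax of terms: each operation preserves effectiveness under a
  common parameter, so \<open>intro eff\<close> proves computability of a definition by descending
  its body. Bound variables are paired with the parameter.\<close>

named_theorems eff

lemma eff_comp: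
  assumes "effective f" "effective g"
  shows "effective (\<lambda>x. f (g x))"
  using assms unfolding effective_def by (metis computable_comp)

text \<open>Composition with an explicit inner function, for predicates given through
  \<open>fst\<close> and \<open>snd\<close> that are evaluated at rearranged or decoded
  components.\<close>

lemma eff_subst:
  assumes "effective f" "effective g" "\<And>x. h x = f (g x)"
  shows "effective h"
  using eff_comp [OF assms(1,2)] assms(3) by presburger

lemma eff_ident [eff]: "effective (\<lambda>x. x)"
  by (rule effectiveI [OF computable_ident]) simp

lemma eff_const [eff]: "effective (\<lambda>x. c)"
  by (rule effectiveI [OF computable_const]) simp

lemma eff_Pair [eff]:
  assumes "effective f" "effective g"
  shows "effective (\<lambda>x. (f x, g x))"
proof -
  obtain f' g' where "computable f'" "computable g'"
    and "\<And>x. f' (enc x) = enc (f x)" "\<And>x. g' (enc x) = enc (g x)"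
    using assms by (auto simp: effective_def)
  then show ?thesis
    by (intro effectiveI [of "\<lambda>n. prod_encode (f' n, g' n)"] computable_pair) (auto simp: enc_Pair)
qed

lemma eff_fst [eff]: "effective f \<Longrightarrow> effective (\<lambda>x. fst (f x))"
  by (rule eff_comp [of fst f]) (rule effectiveI [OF computable_fst], simp add: enc_prod_def)

lemma eff_snd [eff]: "effective f \<Longrightarrow> effective (\<lambda>x. snd (f x))"
  by (rule eff_comp [of snd f]) (rule effectiveI [OF computable_snd], simp add: enc_prod_def)

lemma eff_prod_encode [eff]:
  "effective f \<Longrightarrow> effective (\<lambda>x. prod_encode (f x))" for f :: "'a::enc \<Rightarrow> nat \<times> nat"
  by (rule eff_comp [of prod_encode f]) (rule effectiveI [OF computable_ident], simp add: enc_prod_def)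

lemma eff_prod_decode [eff]: "effective f \<Longrightarrow> effective (\<lambda>x. prod_decode (f x))"
  by (rule eff_comp [of prod_decode f]) (rule effectiveI [OF computable_ident], simp add: enc_prod_def)

lemma eff_case_prod [eff]:
  "effective (\<lambda>x. f x (fst (p x)) (snd (p x))) \<Longrightarrow> effective (\<lambda>x. case p x of (a, b) \<Rightarrow> f x a b)"
  by (simp add: case_prod_beta)

lemma eff_Suc [eff]: "effective f \<Longrightarrow> effective (\<lambda>x. Suc (f x))"
  by (rule eff_comp [of Suc f]) (rule effectiveI [OF computable_Suc], simp)

text \<open>The recursion runs on codes: by induction, iterating \<open>F'\<close> from the code of
  \<open>h x\<close> yields the code of the true value.\<close>

lemma eff_rec_nat [eff]:
  fixes h :: "'a::enc \<Rightarrow> 'b::enc"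
  assumes "effective n" "effective h" "effective (\<lambda>z. F (fst z) (fst (snd z)) (snd (snd z)))"
  shows "effective (\<lambda>x. rec_nat (h x) (F x) (n x))"
proof -
  obtain n' h' F' where c: "computable n'" "computable h'" "computable F'"
    and n': "\<And>x. n' (enc x) = n x" and h': "\<And>x. h' (enc x) = enc (h x)"
    and F': "\<And>z. F' (enc z) = enc (F (fst z) (fst (snd z)) (snd (snd z)))"
    using assms by (auto simp: effective_def)
  let ?R = "\<lambda>x. rec_nat (h' (fst (prod_decode x)))
    (\<lambda>m r. F' (prod_encode (fst (prod_decode x), prod_encode (m, r)))) (snd (prod_decode x))"
  have F'': "F' (prod_encode (enc x, prod_encode (m, enc r))) = enc (F x m r)" for x m r
    using F' [of "(x, m, r)"] by (simp add: enc_Pair)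
  have "rec_nat (enc (h x)) (\<lambda>m r. F' (prod_encode (enc x, prod_encode (m, r)))) k =
      enc (rec_nat (h x) (F x) k)" for x k
    by (induction k) (simp_all add: F'')
  then have "?R (prod_encode (enc x, n' (enc x))) = enc (rec_nat (h x) (F x) (n x))" for x
    by (simp add: n' h')
  then show ?thesis
    by (intro effectiveI [of "\<lambda>x. ?R (prod_encode (x, n' x))"]
        computable_comp [OF computable_rec_nat [OF c(2,3)]] computable_pair computable_ident c)
qed

lemma eff_funpow [eff]:
  fixes F :: "'a::enc \<Rightarrow> 'b::enc \<Rightarrow> 'b"
  assumes "effective n" "effective h" "effective (\<lambda>z. F (fst z) (snd z))"
  shows "effective (\<lambda>x. (F x ^^ n x) (h x))"
proof -
  have *: "(F x ^^ k) a = rec_nat a (\<lambda>_ r. F x r) k" for x k and a :: 'b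
    by (induction k) simp_all
  have F: "effective (\<lambda>z. F (fst z) (snd (snd z)))"
    by (rule eff_subst [OF assms(3), of "\<lambda>z. (fst z, snd (snd z))"]) (intro eff | simp)+
  show ?thesis
    unfolding * by (intro eff assms F)
qed

lemma eff_plus [eff]:
  "effective f \<Longrightarrow> effective g \<Longrightarrow> effective (\<lambda>x. f x + g x)" for f g :: "'a::enc \<Rightarrow> nat"
proof -
  assume "effective f" "effective g"
  moreover have "f x + g x = (Suc ^^ f x) (g x)" for x by simp
  ultimately show ?thesis by (simp only:) (intro eff)
qed

lemma eff_pred: "effective f \<Longrightarrow> effective (\<lambda>x. f x - Suc 0)"
proof -
  assume "effective f"
  moreover have "f x - Suc 0 = rec_nat 0 (\<lambda>m r. m) (f x)" for x by (cases "f x") simp_all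
  ultimately show ?thesis by (simp only:) (intro eff)
qed

lemma eff_minus [eff]:
  "effective f \<Longrightarrow> effective g \<Longrightarrow> effective (\<lambda>x. f x - g x)" for f g :: "'a::enc \<Rightarrow> nat"
proof -
  assume *: "effective f" "effective g"
  have eq: "((\<lambda>r. r - Suc 0) ^^ b) a = a - b" for a b
    by (induction b) simp_all
  have "effective (\<lambda>x. ((\<lambda>r. r - Suc 0) ^^ g x) (f x))"
    by (intro eff eff_pred *)
  then show ?thesis by (simp only: eq)
qed

lemma eff_times [eff]:
  "effective f \<Longrightarrow> effective g \<Longrightarrow> effective (\<lambda>x. f x * g x)" for f g :: "'a::enc \<Rightarrow> nat"
proof -
  assume *: "effective f" "effective g"
  have eq: "a * b = ((\<lambda>r. r + a) ^^ b) 0" for a b :: nat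
    by (induction b) simp_all
  have f: "effective (\<lambda>z. f (fst z))" by (rule eff_comp [OF *(1)]) (intro eff)
  show ?thesis unfolding eq by (intro eff * f)
qed

text \<open>The conditional is a recursion of length 0 or 1: the truth value, read as a number,
  counts the steps.\<close>

lemma eff_If [eff]:
  assumes "effective P" "effective f" "effective g"
  shows "effective (\<lambda>x. if P x then f x else g x)"
proof -
  have f: "effective (\<lambda>z. f (fst z))" by (rule eff_comp [OF assms(2)]) (intro eff)
  have P: "effective (\<lambda>x. of_bool (P x) :: nat)"
    using assms(1) by (auto simp: effective_def enc_bool_def)
  have "effective (\<lambda>x. rec_nat (g x) (\<lambda>_ _. f x) (of_bool (P x)))"
    by (intro eff assms P f)
  moreover have "(if P x then f x else g x) = rec_nat (g x) (\<lambda>_ _. f x) (of_bool (P x))" for x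
    by simp
  ultimately show ?thesis by simp
qed

lemma eff_not [eff]: "effective P \<Longrightarrow> effective (\<lambda>x. \<not> P x)"
proof -
  assume "effective P"
  then have "effective (\<lambda>x. if P x then False else True)" by (intro eff)
  then show ?thesis by (rule back_subst [of effective]) auto
qed

lemma eff_conj [eff]: "effective P \<Longrightarrow> effective Q \<Longrightarrow> effective (\<lambda>x. P x \<and> Q x)"
proof -
  assume "effective P" "effective Q"
  then have "effective (\<lambda>x. if P x then Q x else False)" by (intro eff)
  then show ?thesis by (rule back_subst [of effective]) auto
qed

lemma eff_disj [eff]: "effective P \<Longrightarrow> effective Q \<Longrightarrow> effective (\<lambda>x. P x \<or> Q x)"
proof -
  assume "effective P" "effective Q"
  then have "effective (\<lambda>x. \<not> (\<not> P x \<and> \<not> Q x))" by (intro eff)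
  then show ?thesis by simp
qed

lemma eff_imp [eff]: "effective P \<Longrightarrow> effective Q \<Longrightarrow> effective (\<lambda>x. P x \<longrightarrow> Q x)"
proof -
  assume "effective P" "effective Q"
  then have "effective (\<lambda>x. \<not> P x \<or> Q x)" by (intro eff)
  then show ?thesis by (simp only: imp_conv_disj)
qed

lemma effective_zero: "effective f \<Longrightarrow> effective (\<lambda>x. f x = (0::nat))"
proof -
  assume "effective f"
  then have "effective (\<lambda>x. rec_nat True (\<lambda>_ _. False) (f x))" by (intro eff)
  moreover have "f x = 0 \<longleftrightarrow> rec_nat True (\<lambda>_ _. False) (f x)" for x by (cases "f x") simp_all
  ultimately show ?thesis by simp
qed

lemma eff_le [eff]:
  "effective f \<Longrightarrow> effective g \<Longrightarrow> effective (\<lambda>x. f x \<le> g x)" for f g :: "'a::enc \<Rightarrow> nat"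
  using effective_zero [OF eff_minus [of f g]] by simp

lemma eff_less [eff]:
  "effective f \<Longrightarrow> effective g \<Longrightarrow> effective (\<lambda>x. f x < g x)" for f g :: "'a::enc \<Rightarrow> nat"
  unfolding less_eq_Suc_le by (intro eff)

lemma eff_enc: "effective f \<Longrightarrow> effective (\<lambda>x. enc (f x))"
  by (auto simp: effective_def)

lemma eff_eq [eff]:
  assumes "effective f" "effective g"
  shows "effective (\<lambda>x. f x = g x)"
proof -
  have "effective (\<lambda>x. enc (f x) \<le> enc (g x) \<and> enc (g x) \<le> enc (f x))"
    by (intro eff eff_enc assms)
  moreover have "f x = g x \<longleftrightarrow> enc (f x) \<le> enc (g x) \<and> enc (g x) \<le> enc (f x)" for x
    by (metis antisym enc_eq_iff order_refl)
  ultimately show ?thesis by simp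
qed

lemma eff_All_less [eff]:
  fixes P :: "'a::enc \<Rightarrow> nat \<Rightarrow> bool"
  assumes "effective n" "effective (\<lambda>z. P (fst z) (snd z))"
  shows "effective (\<lambda>x. \<forall>y<n x. P x y)"
proof -
  have P: "effective (\<lambda>z. P (fst z) (fst (snd z)))"
    by (rule eff_subst [OF assms(2), of "\<lambda>z. (fst z, fst (snd z))"]) (intro eff | simp)+
  have "(\<forall>y<k. P x y) \<longleftrightarrow> rec_nat True (\<lambda>m r. r \<and> P x m) k" for x and k :: nat
    by (induction k) (auto simp: less_Suc_eq)
  moreover have "effective (\<lambda>x. rec_nat True (\<lambda>m r. r \<and> P x m) (n x))"
    by (intro eff assms P)
  ultimately show ?thesis by simp
qed

lemma eff_Ex_less [eff]:
  fixes P :: "'a::enc \<Rightarrow> nat \<Rightarrow> bool"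
  assumes "effective n" "effective (\<lambda>z. P (fst z) (snd z))"
  shows "effective (\<lambda>x. \<exists>y<n x. P x y)"
proof -
  have "effective (\<lambda>x. \<not> (\<forall>y<n x. \<not> P x y))"
    by (intro eff assms)
  then show ?thesis by simp
qed

lemma eff_even [eff]: "effective f \<Longrightarrow> effective (\<lambda>x. even (f x))" for f :: "'a::enc \<Rightarrow> nat"
proof -
  assume *: "effective f"
  have "even k \<longleftrightarrow> rec_nat True (\<lambda>_ r. \<not> r) k" for k :: nat
    by (induction k) simp_all
  then show ?thesis by (simp only:) (intro eff *)
qed

lemma eff_div2 [eff]: "effective f \<Longrightarrow> effective (\<lambda>x. f x div 2)" for f :: "'a::enc \<Rightarrow> nat"
proof -
  assume *: "effective f"
  have "k div 2 = rec_nat 0 (\<lambda>m r. if even m then r else Suc r) k" for k :: nat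
    by (induction k) auto
  then show ?thesis by (simp only:) (intro eff *)
qed

lemma eff_mod [eff]:
  "effective f \<Longrightarrow> effective g \<Longrightarrow> effective (\<lambda>x. f x mod g x)" for f g :: "'a::enc \<Rightarrow> nat"
proof -
  assume *: "effective f" "effective g"
  have g: "effective (\<lambda>z. g (fst z))" by (rule eff_comp [OF *(2)]) (intro eff)
  have "m mod n = rec_nat 0 (\<lambda>_ r. if Suc r = n then 0 else Suc r) m" for m n :: nat
    by (induction m) (auto simp: mod_Suc)
  then show ?thesis by (simp only:) (intro eff * g)
qed

lemma computable_Least:
  fixes P :: "nat \<Rightarrow> nat \<Rightarrow> bool"
  assumes "effective (\<lambda>z. P (fst z) (snd z))" "\<And>x. \<exists>n. P x n"
  shows "computable (\<lambda>x. LEAST n. P x n)"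
proof -
  \<comment> \<open>The negation is computed because \<open>False\<close> has code 0 and
    \<open>mu_least\<close> looks for zeros.\<close>
  obtain g where g: "computable g" "\<And>z. g (enc z) = enc (\<not> P (fst z) (snd z))"
    using eff_not [OF assms(1)] unfolding effective_def by blast
  have g0: "g (prod_encode (x, n)) = 0 \<longleftrightarrow> P x n" for x n
    using g(2) [of "(x, n)"] by (simp add: enc_Pair enc_bool_def)
  have "partial_recursive (\<lambda>a. mu_least (\<lambda>n. Some (g (prod_encode (a, n)))))"
    using partial_recursive.mu g(1) by (auto simp: computable_def)
  moreover have "mu_least (\<lambda>n. Some (g (prod_encode (x, n)))) = Some (LEAST n. P x n)" for x
    using assms(2) by (simp add: mu_least_def g0)
  ultimately show ?thesis by (simp add: computable_def)
qed

lemma partial_recursive_Least: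
  fixes P :: "nat \<Rightarrow> nat \<Rightarrow> bool"
  assumes "effective (\<lambda>z. P (fst z) (snd z))"
  shows "partial_recursive (\<lambda>x. if \<exists>n. P x n then Some (LEAST n. P x n) else None)"
proof -
  obtain g where g: "computable g" "\<And>z. g (enc z) = enc (\<not> P (fst z) (snd z))"
    using eff_not [OF assms(1)] unfolding effective_def by blast
  have g0: "g (prod_encode (x, n)) = 0 \<longleftrightarrow> P x n" for x n
    using g(2) [of "(x, n)"] by (simp add: enc_Pair enc_bool_def)
  have "partial_recursive (\<lambda>a. mu_least (\<lambda>n. Some (g (prod_encode (a, n)))))"
    using partial_recursive.mu g(1) by (auto simp: computable_def)
  then show ?thesis by (simp add: mu_least_def g0 cong: if_cong)
qed

text \<open>\<open>hd []\<close> is an unspecified but fixed value, which the witness can output.\<close>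

lemma eff_hd [eff]: "effective f \<Longrightarrow> effective (\<lambda>x. hd (f x))"
proof (rule eff_comp [of hd f])
  let ?g = "\<lambda>n. if n = 0 then enc (hd [] :: 'b) else fst (prod_decode (n - 1))"
  have "computable ?g"
    unfolding effective_nat_iff [symmetric] by (intro eff)
  moreover have "?g (enc xs) = enc (hd xs)" for xs :: "'b list"
    by (cases xs) simp_all
  ultimately show "effective (hd :: 'b list \<Rightarrow> 'b)" by (rule effectiveI)
qed

lemma eff_tl [eff]: "effective f \<Longrightarrow> effective (\<lambda>x. tl (f x))"
proof (rule eff_comp [of tl f])
  let ?g = "\<lambda>n. if n = 0 then 0 else snd (prod_decode (n - 1))"
  have "computable ?g"
    unfolding effective_nat_iff [symmetric] by (intro eff)
  moreover have "?g (enc xs) = enc (tl xs)" for xs :: "'b list"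
    by (cases xs) simp_all
  ultimately show "effective (tl :: 'b list \<Rightarrow> 'b list)" by (rule effectiveI)
qed

lemma eff_Cons [eff]:
  assumes "effective f" "effective g"
  shows "effective (\<lambda>x. f x # g x)"
proof -
  obtain f' g' where "computable f'" "computable g'"
    and "\<And>x. f' (enc x) = enc (f x)" "\<And>x. g' (enc x) = enc (g x)"
    using assms by (auto simp: effective_def)
  then show ?thesis
    by (intro effectiveI [of "\<lambda>n. Suc (prod_encode (f' n, g' n))"]
        computable_comp [OF computable_Suc] computable_pair) auto
qed

lemma length_le_enc: "length xs \<le> enc xs"
proof (induction xs)
  case (Cons x xs)
  then show ?case using le_prod_encode_2 [of "enc xs" "enc x"] by simp
qed simp

text \<open>A step consuming one element is iterated. The number of rounds need only be at least the
  length, and the code of the list is such a bound; surplus rounds change nothing.\<close>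

lemma eff_fold [eff]:
  assumes "effective xs" "effective a" "effective (\<lambda>z. F (fst z) (fst (snd z)) (snd (snd z)))"
  shows "effective (\<lambda>x. fold (F x) (xs x) (a x))"
proof -
  define step where
    "step x p = (if fst p = [] then p else (tl (fst p), F x (hd (fst p)) (snd p)))" for x p
  have eq: "(step x ^^ k) (ys, b) = (drop k ys, fold (F x) (take k ys) b)" for x k ys b
  proof (induction k arbitrary: ys b)
    case (Suc k)
    have "(step x ^^ Suc k) (ys, b) = (step x ^^ k) (step x (ys, b))"
      by (simp only: funpow_Suc_right o_apply)
    also have "\<dots> = (drop (Suc k) ys, fold (F x) (take (Suc k) ys) b)"
      by (cases ys) (simp_all add: Suc step_def)
    finally show ?case .
  qed simp
  have F: "effective (\<lambda>z. F (fst z) (hd (fst (snd z))) (snd (snd z)))"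
    by (rule eff_subst [OF assms(3), of "\<lambda>z. (fst z, hd (fst (snd z)), snd (snd z))"]) (intro eff | simp)+
  have "effective (\<lambda>x. snd ((step x ^^ enc (xs x)) (xs x, a x)))"
    unfolding step_def by (intro eff eff_enc assms F)
  then show ?thesis by (simp add: eq length_le_enc)
qed

lemma eff_rev [eff]: "effective f \<Longrightarrow> effective (\<lambda>x. rev (f x))"
proof -
  assume "effective f"
  then have "effective (\<lambda>x. fold (\<lambda>a as. a # as) (f x) [])" by (intro eff)
  then show ?thesis by (simp add: fold_Cons_rev)
qed

lemma eff_foldr [eff]:
  assumes "effective xs" "effective a" "effective (\<lambda>z. F (fst z) (fst (snd z)) (snd (snd z)))"
  shows "effective (\<lambda>x. foldr (F x) (xs x) (a x))"
  unfolding foldr_conv_fold by (intro eff assms)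

lemma eff_append [eff]: "effective f \<Longrightarrow> effective g \<Longrightarrow> effective (\<lambda>x. f x @ g x)"
proof -
  assume "effective f" "effective g"
  then have "effective (\<lambda>x. foldr (\<lambda>a as. a # as) (f x) (g x))" by (intro eff)
  moreover have "foldr (\<lambda>a as. a # as) xs ys = xs @ ys" for xs ys :: "'b list"
    by (induction xs) simp_all
  ultimately show ?thesis by simp
qed

lemma eff_length [eff]: "effective f \<Longrightarrow> effective (\<lambda>x. length (f x))"
proof -
  assume "effective f"
  then have "effective (\<lambda>x. foldr (\<lambda>_ n. Suc n) (f x) 0)" by (intro eff)
  moreover have "foldr (\<lambda>_ n. Suc n) xs 0 = length xs" for xs :: "'b list"
    by (induction xs) simp_all
  ultimately show ?thesis by simp
qed

lemma eff_list_all [eff]: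
  assumes "effective xs" "effective (\<lambda>z. P (fst z) (snd z))"
  shows "effective (\<lambda>x. \<forall>y\<in>set (xs x). P x y)"
proof -
  have P: "effective (\<lambda>z. P (fst z) (fst (snd z)))"
    by (rule eff_subst [OF assms(2), of "\<lambda>z. (fst z, fst (snd z))"]) (intro eff | simp)+
  have "(\<forall>y\<in>set ys. P x y) \<longleftrightarrow> foldr (\<lambda>y b. P x y \<and> b) ys True" for x ys
    by (induction ys) auto
  moreover have "effective (\<lambda>x. foldr (\<lambda>y b. P x y \<and> b) (xs x) True)"
    by (intro eff assms P)
  ultimately show ?thesis by simp
qed

lemma eff_drop [eff]: "effective n \<Longrightarrow> effective f \<Longrightarrow> effective (\<lambda>x. drop (n x) (f x))"
proof -
  assume "effective n" "effective f"
  then have "effective (\<lambda>x. (tl ^^ n x) (f x))" by (intro eff)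
  moreover have "(tl ^^ k) ys = drop k ys" for k and ys :: "'b list"
    by (induction k) (simp_all add: tl_drop drop_Suc)
  ultimately show ?thesis by simp
qed

section \<open>Semidecidable predicates and an enumeration of programs\<close>

definition semidecidable :: "('a::enc \<Rightarrow> bool) \<Rightarrow> bool" where
  "semidecidable P \<longleftrightarrow> (\<exists>Q. effective (\<lambda>z. Q (fst z) (snd z)) \<and> (\<forall>x. P x \<longleftrightarrow> (\<exists>n::nat. Q x n)))"

lemma semidecidableI:
  assumes "effective (\<lambda>z. Q (fst z) (snd z))" "\<And>x. P x \<longleftrightarrow> (\<exists>n::nat. Q x n)"
  shows "semidecidable P"
  using assms by (auto simp: semidecidable_def)

named_theorems semidec

lemma semidec_eff: "effective P \<Longrightarrow> semidecidable P"
proof (rule semidecidableI [of "\<lambda>x n. P x"])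
  assume "effective P"
  then show "effective (\<lambda>z. P (fst z))" by (rule eff_comp) (intro eff)
qed simp

lemma semidec_comp:
  assumes "semidecidable P" "effective f"
  shows "semidecidable (\<lambda>x. P (f x))"
proof -
  obtain Q where Q: "effective (\<lambda>z. Q (fst z) (snd z))" "\<And>x. P x \<longleftrightarrow> (\<exists>n::nat. Q x n)"
    using assms(1) by (auto simp: semidecidable_def)
  have f: "effective (\<lambda>z. f (fst z))" by (rule eff_comp [OF assms(2)]) (intro eff)
  have "effective (\<lambda>z. Q (f (fst z)) (snd z))"
    by (rule eff_subst [OF Q(1), of "\<lambda>z. (f (fst z), snd z)"]) (intro eff f | simp)+
  then show ?thesis using Q(2) by (intro semidecidableI [of "\<lambda>x n. Q (f x) n"])
qed

lemma semidec_conj [semidec]: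
  assumes "semidecidable P" "semidecidable P'"
  shows "semidecidable (\<lambda>x. P x \<and> P' x)"
proof -
  obtain Q Q' where Q: "effective (\<lambda>z. Q (fst z) (snd z))" "\<And>x. P x \<longleftrightarrow> (\<exists>n::nat. Q x n)"
    and Q': "effective (\<lambda>z. Q' (fst z) (snd z))" "\<And>x. P' x \<longleftrightarrow> (\<exists>n::nat. Q' x n)"
    using assms by (auto simp: semidecidable_def)
  have 1: "effective (\<lambda>z. Q (fst z) (fst (prod_decode (snd z))))"
    by (rule eff_subst [OF Q(1), of "\<lambda>z. (fst z, fst (prod_decode (snd z)))"]) (intro eff | simp)+
  have 2: "effective (\<lambda>z. Q' (fst z) (snd (prod_decode (snd z))))"
    by (rule eff_subst [OF Q'(1), of "\<lambda>z. (fst z, snd (prod_decode (snd z)))"]) (intro eff | simp)+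
  have "P x \<and> P' x \<longleftrightarrow> (\<exists>n. Q x (fst (prod_decode n)) \<and> Q' x (snd (prod_decode n)))" for x
    by (metis Q(2) Q'(2) fst_conv snd_conv prod_encode_inverse)
  then show ?thesis
    by (intro semidecidableI [of "\<lambda>x n. Q x (fst (prod_decode n)) \<and> Q' x (snd (prod_decode n))"]
        eff 1 2)
qed

lemma semidec_disj [semidec]:
  assumes "semidecidable P" "semidecidable P'"
  shows "semidecidable (\<lambda>x. P x \<or> P' x)"
proof -
  obtain Q Q' where Q: "effective (\<lambda>z. Q (fst z) (snd z))" "\<And>x. P x \<longleftrightarrow> (\<exists>n::nat. Q x n)"
    and Q': "effective (\<lambda>z. Q' (fst z) (snd z))" "\<And>x. P' x \<longleftrightarrow> (\<exists>n::nat. Q' x n)"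
    using assms by (auto simp: semidecidable_def)
  show ?thesis
    by (intro semidecidableI [of "\<lambda>x n. Q x n \<or> Q' x n"] eff Q(1) Q'(1)) (auto simp: Q(2) Q'(2))
qed

lemma semidec_Ex [semidec]:
  fixes P :: "'a::enc \<Rightarrow> nat \<Rightarrow> bool"
  assumes "semidecidable (\<lambda>z. P (fst z) (snd z))"
  shows "semidecidable (\<lambda>x. \<exists>y. P x y)"
proof -
  obtain Q where Q: "effective (\<lambda>z. Q (fst z) (snd z))"
    "\<And>z. P (fst z) (snd z) \<longleftrightarrow> (\<exists>n::nat. Q z n)"
    using assms by (auto simp: semidecidable_def)
  have P: "P x y \<longleftrightarrow> (\<exists>n. Q (x, y) n)" for x y using Q(2) [of "(x, y)"] by simp
  let ?d = "\<lambda>n. prod_decode n"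
  have 1: "effective (\<lambda>z. Q (fst z, fst (?d (snd z))) (snd (?d (snd z))))"
    by (rule eff_subst [OF Q(1), of "\<lambda>z. ((fst z, fst (?d (snd z))), snd (?d (snd z)))"])
      (intro eff | simp)+
  have "(\<exists>y. P x y) \<longleftrightarrow> (\<exists>n. Q (x, fst (?d n)) (snd (?d n)))" for x
    by (metis P fst_conv snd_conv prod_encode_inverse)
  with 1 show ?thesis by (rule semidecidableI)
qed

text \<open>The search runs over coded pairs of a value and a certificate for it. It returns the
  value of the first pair found, which need not be the least \<open>y\<close>.\<close>

lemma semidec_select:
  fixes P :: "nat \<Rightarrow> nat \<Rightarrow> bool"
  assumes "semidecidable (\<lambda>z. P (fst z) (snd z))" "\<And>x. \<exists>y. P x y"
  obtains f where "computable f" "\<And>x. P x (f x)"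
proof -
  obtain Q where Q: "effective (\<lambda>z. Q (fst z) (snd z))"
    "\<And>z. P (fst z) (snd z) \<longleftrightarrow> (\<exists>n::nat. Q z n)"
    using assms by (auto simp: semidecidable_def)
  have P: "P x y \<longleftrightarrow> (\<exists>n. Q (x, y) n)" for x y using Q(2) [of "(x, y)"] by simp
  let ?d = "\<lambda>n. prod_decode n"
  let ?R = "\<lambda>x n. Q (x, fst (?d n)) (snd (?d n))"
  have 1: "effective (\<lambda>z. ?R (fst z) (snd z))"
    by (rule eff_subst [OF Q(1), of "\<lambda>z. ((fst z, fst (?d (snd z))), snd (?d (snd z)))"])
      (intro eff | simp)+
  have ex: "\<exists>n. ?R x n" for x
    using assms(2) [of x] by (metis P fst_conv snd_conv prod_encode_inverse)
  have "computable (\<lambda>x. LEAST n. ?R x n)"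
    by (rule computable_Least [OF 1 ex])
  then have "computable (\<lambda>x. fst (?d (LEAST n. ?R x n)))"
    unfolding effective_nat_iff [symmetric] by (intro eff)
  moreover have "P x (fst (?d (LEAST n. ?R x n)))" for x
    using LeastI_ex [OF ex [of x]] P by blast
  ultimately show ?thesis by (rule that)
qed

text \<open>Every number codes a candidate and a possible certificate. Failing pairs yield the
  default \<open>a\<close>, which is why one solution must be supplied.\<close>

lemma semidec_enumerate:
  fixes P :: "'a::enc \<Rightarrow> bool" and c :: "nat \<Rightarrow> 'a"
  assumes "semidecidable P" "P a" "effective c" "surj c"
  obtains u :: "nat \<Rightarrow> 'a" where "effective u" "range u = {x. P x}"
proof -
  obtain Q where Q: "effective (\<lambda>z. Q (fst z) (snd z))" "\<And>x. P x \<longleftrightarrow> (\<exists>n::nat. Q x n)"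
    using assms by (auto simp: semidecidable_def)
  let ?d = "\<lambda>n. prod_decode n"
  define u where "u n = (if Q (c (fst (?d n))) (snd (?d n)) then c (fst (?d n)) else a)" for n
  have c: "effective (\<lambda>n. c (fst (?d n)))" by (rule eff_comp [OF assms(3)]) (intro eff)
  have "effective (\<lambda>n. Q (c (fst (?d n))) (snd (?d n)))"
    by (rule eff_subst [OF Q(1), of "\<lambda>n. (c (fst (?d n)), snd (?d n))"]) (intro eff c | simp)+
  then have "effective u" unfolding u_def by (intro eff c)
  moreover have "range u = {x. P x}"
  proof (intro set_eqI iffI)
    fix x assume "x \<in> {x. P x}"
    then obtain n where "Q x n" using Q(2) by blast
    moreover obtain m where "x = c m" using assms(4) by (metis surjD)
    ultimately have "u (prod_encode (m, n)) = x" by (simp add: u_def)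
    then show "x \<in> range u" by blast
  qed (use Q(2) assms(2) in \<open>auto simp: u_def\<close>)
  ultimately show ?thesis by (rule that)
qed

text \<open>Derivations with at most two premises are numbered so that both premises precede the
  conclusion; a table of all earlier values turns this recursion into a primitive one.\<close>

lemma derivation_enumeration:
  fixes F :: "'a::enc \<Rightarrow> 'a \<Rightarrow> nat \<Rightarrow> 'a"
  assumes F: "effective (\<lambda>z. F (fst z) (fst (snd z)) (snd (snd z)))"
  obtains g :: "nat \<Rightarrow> 'a" where "effective g" "g 0 = a" "\<And>i j n. \<exists>c. g c = F (g i) (g j) n"
    "\<And>P c. P a \<Longrightarrow> (\<And>x y n. P x \<Longrightarrow> P y \<Longrightarrow> P (F x y n)) \<Longrightarrow> P (g c)"
proof -
  let ?i = "\<lambda>s. fst (prod_decode s)"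
  let ?j = "\<lambda>s. fst (prod_decode (snd (prod_decode s)))"
  let ?n = "\<lambda>s. snd (prod_decode (snd (prod_decode s)))"
  \<comment> \<open>\<open>T s\<close> lists \<open>g s\<close>, ..., \<open>g 0\<close>, latest
    first. Dropping \<open>s - i\<close> entries leaves \<open>T i\<close>, whose head is
    \<open>g i\<close>.\<close>
  define T where "T = rec_nat [a]
    (\<lambda>s L. F (hd (drop (s - ?i s) L)) (hd (drop (s - ?j s) L)) (?n s) # L)"
  define g where "g s = hd (T s)" for s
  have T_Suc: "T (Suc s) = F (hd (drop (s - ?i s) (T s))) (hd (drop (s - ?j s) (T s))) (?n s) # T s"
    for s by (simp add: T_def)
  have "drop k (T (i + k)) = T i" for i k
    by (induction k) (simp_all add: T_Suc)
  then have drop_T: "drop (s - i) (T s) = T i" if "i \<le> s" for i s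
    using that by (metis le_add_diff_inverse)
  have s_eq: "s = prod_encode (?i s, prod_encode (?j s, ?n s))" for s
    by simp
  have i_le: "?i s \<le> s" and j_le: "?j s \<le> s" for s
    using s_eq [of s] le_prod_encode_1 le_prod_encode_2 by (metis, metis order.trans)
  have g_Suc: "g (Suc s) = F (g (?i s)) (g (?j s)) (?n s)" for s
    using i_le j_le by (simp add: g_def T_Suc drop_T)
  show ?thesis
  proof
    have "effective (\<lambda>z. F (hd (drop (fst (snd z) - ?i (fst (snd z))) (snd (snd z))))
        (hd (drop (fst (snd z) - ?j (fst (snd z))) (snd (snd z)))) (?n (fst (snd z))))"
      by (rule eff_subst [OF F, of "\<lambda>z. (hd (drop (fst (snd z) - ?i (fst (snd z))) (snd (snd z))),
          hd (drop (fst (snd z) - ?j (fst (snd z))) (snd (snd z))), ?n (fst (snd z)))"])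
        (intro eff | simp)+
    then show "effective g"
      unfolding g_def T_def by (intro eff)
    show "g 0 = a" by (simp add: g_def T_def)
    show "\<exists>c. g c = F (g i) (g j) n" for i j n
      using g_Suc [of "prod_encode (i, prod_encode (j, n))"] by auto
    show "P (g c)" if "P a" "\<And>x y n. P x \<Longrightarrow> P y \<Longrightarrow> P (F x y n)" for P c
    proof (induction c rule: less_induct)
      case (less c)
      show ?case
      proof (cases c)
        case 0
        with that(1) \<open>g 0 = a\<close> show ?thesis by simp
      next
        case (Suc s)
        with less i_le j_le have "P (g (?i s))" "P (g (?j s))"
          by (simp_all add: le_imp_less_Suc)
        then show ?thesis unfolding Suc g_Suc by (rule that(2))
      qed
    qed
  qed
qed

text \<open>\<open>conv e x y\<close> says that program \<open>e\<close> halts on \<open>x\<close> with output \<open>y\<close>. Programs with tag 8 are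
  auxiliary: they halt on \<open>(z, i)\<close> iff the search of \<open>f\<close> at \<open>z\<close> passes all candidates below \<open>i\<close>.\<close>

inductive conv :: "nat \<Rightarrow> nat \<Rightarrow> nat \<Rightarrow> bool" where
  "conv (prod_encode (0, 0)) x 0"
| "conv (prod_encode (1, 0)) x (Suc x)"
| "conv (prod_encode (2, 0)) x (fst (prod_decode x))"
| "conv (prod_encode (3, 0)) x (snd (prod_decode x))"
| "conv f x a \<Longrightarrow> conv g x b \<Longrightarrow> conv (prod_encode (4, prod_encode (f, g))) x (prod_encode (a, b))"
| "conv f b a \<Longrightarrow> conv g x b \<Longrightarrow> conv (prod_encode (5, prod_encode (f, g))) x a"
| "conv f x a \<Longrightarrow> conv (prod_encode (6, prod_encode (f, g))) (prod_encode (x, 0)) a"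
| "conv (prod_encode (6, prod_encode (f, g))) (prod_encode (x, i)) r \<Longrightarrow>
    conv g (prod_encode (x, prod_encode (i, r))) a \<Longrightarrow>
    conv (prod_encode (6, prod_encode (f, g))) (prod_encode (x, Suc i)) a"
| "conv (prod_encode (8, f)) (prod_encode (x, i)) a \<Longrightarrow> conv f (prod_encode (x, i)) 0 \<Longrightarrow>
    conv (prod_encode (7, f)) x i"
| "conv (prod_encode (8, f)) (prod_encode (x, 0)) 0"
| "conv (prod_encode (8, f)) (prod_encode (x, i)) a \<Longrightarrow> conv f (prod_encode (x, i)) (Suc b) \<Longrightarrow>
    conv (prod_encode (8, f)) (prod_encode (x, Suc i)) 0"

lemma conv_enumeration:
  obtains g :: "nat \<Rightarrow> nat \<times> nat \<times> nat" where "effective g" "range g = {(e, x, y). conv e x y}"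
proof -
  let ?d = "prod_decode" and ?e = prod_encode
  \<comment> \<open>\<open>n\<close> codes the number \<open>k\<close> of a clause, 0 to 10 in the
    order of the clauses of \<open>conv\<close>, and a free parameter \<open>m\<close>. When the
    premises do not fit, the value is \<open>p\<close>, so nothing underivable is produced.\<close>
  define F :: "nat \<times> nat \<times> nat \<Rightarrow> nat \<times> nat \<times> nat \<Rightarrow> nat \<Rightarrow> nat \<times> nat \<times> nat" where
    "F p q n = (case p of (f, x, a) \<Rightarrow> case q of (g, y, b) \<Rightarrow> case ?d n of (k, m) \<Rightarrow>
      if k = 0 then (?e (0, 0), m, 0)
      else if k = 1 then (?e (1, 0), m, Suc m)
      else if k = 2 then (?e (2, 0), m, fst (?d m))
      else if k = 3 then (?e (3, 0), m, snd (?d m))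
      else if k = 4 \<and> x = y then (?e (4, ?e (f, g)), x, ?e (a, b))
      else if k = 5 \<and> x = b then (?e (5, ?e (f, g)), y, a)
      else if k = 6 then (?e (6, ?e (f, m)), ?e (x, 0), a)
      else if k = 7 \<and> f = ?e (6, ?e (m, g)) \<and> y = ?e (fst (?d x), ?e (snd (?d x), a))
        then (f, ?e (fst (?d x), Suc (snd (?d x))), b)
      else if k = 8 \<and> f = ?e (8, g) \<and> x = y \<and> b = 0 then (?e (7, g), fst (?d x), snd (?d x))
      else if k = 9 then (?e (8, fst (?d m)), ?e (snd (?d m), 0), 0)
      else if k = 10 \<and> f = ?e (8, g) \<and> x = y \<and> b \<noteq> 0
        then (f, ?e (fst (?d x), Suc (snd (?d x))), 0)
      else p)" for p q n
  have "effective (\<lambda>z. F (fst z) (fst (snd z)) (snd (snd z)))"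
    unfolding F_def by (intro eff)
  then obtain g :: "nat \<Rightarrow> nat \<times> nat \<times> nat" where g: "effective g" "g 0 = (?e (0, 0), 0, 0)"
    and step: "\<And>i j n. \<exists>c. g c = F (g i) (g j) n"
    and ind: "\<And>P c. P (?e (0, 0), 0, 0) \<Longrightarrow> (\<And>x y n. P x \<Longrightarrow> P y \<Longrightarrow> P (F x y n)) \<Longrightarrow> P (g c)"
    by (rule derivation_enumeration [of F "(?e (0, 0), 0, 0)"]) blast
  define C where "C p = (case p of (e, x, y) \<Rightarrow> conv e x y)" for p
  have C: "C (e, x, y) \<longleftrightarrow> conv e x y" for e x y by (simp add: C_def)
  have C_if: "C (if c then r else s)" if "c \<Longrightarrow> C r" "\<not> c \<Longrightarrow> C s" for c r s
    using that by simp
  have sound: "C (g c)" for c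
  proof (rule ind [of C])
    show "C (?e (0, 0), 0, 0)" by (simp add: C conv.intros)
    fix p q :: "nat \<times> nat \<times> nat" and n
    assume *: "C p" "C q"
    obtain f x a g y b k m where p: "p = (f, x, a)" "q = (g, y, b)" "?d n = (k, m)"
      by (metis prod.exhaust)
    obtain z i where x: "x = ?e (z, i)" by (metis prod_decode_inverse surj_pair)
    have pq: "conv f x a" "conv g y b" using * p by (simp_all add: C)
    show "C (F p q n)"
      unfolding F_def p prod.case
    proof (intro C_if, goal_cases)
      case 5
      then show ?case using conv.intros(5) [of f y a g b] pq by (simp add: C)
    next
      case 6
      then show ?case using conv.intros(6) [of f b a g y] pq by (simp add: C)
    next
      case 8
      then show ?case using conv.intros(8) [of m g z i a b] pq x by (simp add: C)
    next
      case 9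
      then have "f = ?e (8, g)" "y = ?e (z, i)" "b = 0" using x by simp_all
      then show ?case using conv.intros(9) [of g z i a] pq by (simp add: C x)
    next
      case 11
      then obtain b' where "b = Suc b'" using not0_implies_Suc by blast
      moreover from 11 have "f = ?e (8, g)" "y = ?e (z, i)" using x by simp_all
      ultimately show ?case using conv.intros(11) [of g z i a b'] pq by (simp add: C x)
    qed (simp_all add: C pq conv.intros(1,3,4,7,10) conv.intros(2) [simplified])
  qed
  have step': "F p q n \<in> range g" if pq: "p \<in> range g" "q \<in> range g" for p q n
  proof -
    obtain i j where "p = g i" "q = g j" using pq by blast
    moreover obtain c where "g c = F (g i) (g j) n" using step by blast
    ultimately show ?thesis by (metis rangeI)
  qed
  have base: "g 0 \<in> range g" by blast
  have "(e, x, y) \<in> range g" if "conv e x y" for e x y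
    using that
  proof induction
    case (1 x)
    then show ?case using step' [OF base base, of "?e (0, x)"] by (simp add: F_def split: prod.splits)
  next
    case (2 x)
    then show ?case using step' [OF base base, of "?e (1, x)"] by (simp add: F_def split: prod.splits)
  next
    case (3 x)
    then show ?case using step' [OF base base, of "?e (2, x)"] by (simp add: F_def split: prod.splits)
  next
    case (4 x)
    then show ?case using step' [OF base base, of "?e (3, x)"] by (simp add: F_def split: prod.splits)
  next
    case (5 f x a g b)
    then show ?case using step' [OF 5(3,4), of "?e (4, 0)"] by (simp add: F_def)
  next
    case (6 f b a g x)
    then show ?case using step' [OF 6(3,4), of "?e (5, 0)"] by (simp add: F_def)
  next
    case (7 f x a g)
    then show ?case using step' [OF 7(2,2), of "?e (6, g)"] by (simp add: F_def)
  next
    case (8 f g x i r a)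
    then show ?case using step' [OF 8(3,4), of "?e (7, f)"] by (simp add: F_def)
  next
    case (9 f x i a)
    then show ?case using step' [OF 9(3,4), of "?e (8, 0)"] by (simp add: F_def)
  next
    case (10 f x)
    then show ?case using step' [OF base base, of "?e (9, ?e (f, x))"]
      by (simp add: F_def split: prod.splits)
  next
    case (11 f x i a b)
    then show ?case using step' [OF 11(3,4), of "?e (10, 0)"] by (simp add: F_def)
  qed
  then have "{(e, x, y). conv e x y} \<subseteq> range g" by blast
  moreover have "range g \<subseteq> {(e, x, y). conv e x y}"
  proof clarify
    fix e x y c assume "(e, x, y) = g c"
    then show "conv e x y" using sound [of c] C by metis
  qed
  ultimately have "range g = {(e, x, y). conv e x y}" by blast
  with g(1) show ?thesis by (rule that)
qed

text \<open>A clause for minimization would need one premise per rejected candidate. The auxiliary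
  programs chain these premises, so that every clause of \<open>conv\<close> has at most
  two.\<close>

lemma conv_aux_iff:
  "(\<exists>a. conv (prod_encode (8, f)) (prod_encode (x, i)) a) \<longleftrightarrow>
    (\<forall>j<i. \<exists>b. conv f (prod_encode (x, j)) (Suc b))"
proof (induction i)
  case 0
  then show ?case using conv.intros(10) by auto
next
  case (Suc i)
  have "(\<exists>a. conv (prod_encode (8, f)) (prod_encode (x, Suc i)) a) \<longleftrightarrow>
      (\<exists>a. conv (prod_encode (8, f)) (prod_encode (x, i)) a) \<and>
      (\<exists>b. conv f (prod_encode (x, i)) (Suc b))"
    by (subst conv.simps) (auto simp: prod_encode_eq)
  with Suc show ?case by (auto simp: less_Suc_eq)
qed

lemma conv_complete:
  assumes "partial_recursive f"
  shows "\<exists>e. \<forall>x y. conv e x y \<longleftrightarrow> f x = Some y"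
  using assms
proof induction
  case zero
  show ?case by (rule exI [of _ "prod_encode (0, 0)"], subst conv.simps) (auto simp: prod_encode_eq)
next
  case succ
  show ?case by (rule exI [of _ "prod_encode (1, 0)"], subst conv.simps) (auto simp: prod_encode_eq)
next
  case proj1
  show ?case by (rule exI [of _ "prod_encode (2, 0)"], subst conv.simps) (auto simp: prod_encode_eq)
next
  case proj2
  show ?case by (rule exI [of _ "prod_encode (3, 0)"], subst conv.simps) (auto simp: prod_encode_eq)
next
  case (pair f g)
  then obtain e e' where "\<And>x y. conv e x y \<longleftrightarrow> f x = Some y" "\<And>x y. conv e' x y \<longleftrightarrow> g x = Some y"
    by blast
  then show ?case
    by (intro exI [of _ "prod_encode (4, prod_encode (e, e'))"], subst conv.simps)
      (auto simp: prod_encode_eq bind_eq_Some_conv)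
next
  case (comp f g)
  then obtain e e' where "\<And>x y. conv e x y \<longleftrightarrow> f x = Some y" "\<And>x y. conv e' x y \<longleftrightarrow> g x = Some y"
    by blast
  then show ?case
    by (intro exI [of _ "prod_encode (5, prod_encode (e, e'))"], subst conv.simps)
      (auto simp: prod_encode_eq bind_eq_Some_conv)
next
  case (prim_rec f g)
  then obtain e e' where e: "\<And>x y. conv e x y \<longleftrightarrow> f x = Some y" "\<And>x y. conv e' x y \<longleftrightarrow> g x = Some y"
    by blast
  let ?e = "prod_encode (6, prod_encode (e, e'))"
  have *: "conv ?e (prod_encode (a, n)) y \<longleftrightarrow>
      prim_iter (f a) (\<lambda>m r. g (prod_encode (a, prod_encode (m, r)))) n = Some y" for a n y
  proof (induction n arbitrary: y)
    case 0
    show ?case by (subst conv.simps) (auto simp: prod_encode_eq e)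
  next
    case (Suc n)
    show ?case
      by (subst conv.simps) (auto simp: prod_encode_eq e Suc bind_eq_Some_conv)
  qed
  show ?case
  proof (intro exI [of _ ?e] allI)
    fix x y
    obtain a n where "x = prod_encode (a, n)" by (metis prod_decode_inverse surj_pair)
    then show "conv ?e x y \<longleftrightarrow> (case prod_decode x of (a, n) \<Rightarrow>
        prim_iter (f a) (\<lambda>m r. g (prod_encode (a, prod_encode (m, r)))) n) = Some y"
      by (simp add: *)
  qed
next
  case (mu f)
  then obtain e where e: "\<And>x y. conv e x y \<longleftrightarrow> f x = Some y" by blast
  let ?g = "\<lambda>a n. f (prod_encode (a, n))"
  have 1: "conv (prod_encode (7, e)) a n \<longleftrightarrow> ?g a n = Some 0 \<and> (\<forall>j<n. \<exists>b. ?g a j = Some (Suc b))" for a n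
    using conv_aux_iff [of e a n] by (subst conv.simps) (auto simp: prod_encode_eq e)
  have 2: "mu_least h = Some n \<longleftrightarrow> h n = Some 0 \<and> (\<forall>j<n. \<exists>b. h j = Some (Suc b))" (is "?L \<longleftrightarrow> ?R")
    for h :: "nat \<Rightarrow> nat option" and n
  proof
    assume ?L
    then obtain m where m: "h m = Some 0" "\<forall>j<m. h j \<noteq> None" and n: "n = (LEAST n. h n = Some 0)"
      by (auto simp: mu_least_def split: if_splits)
    have "h n = Some 0" using m n by (metis (mono_tags, lifting) LeastI)
    moreover have "\<exists>b. h j = Some (Suc b)" if "j < n" for j
    proof -
      have "h j \<noteq> Some 0" using that n not_less_Least by blast
      moreover have "n \<le> m" using m n by (simp add: Least_le)
      ultimately show ?thesis using that m by (metis not0_implies_Suc option.exhaust order_less_le_trans)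
    qed
    ultimately show ?R by blast
  next
    assume R: ?R
    then have "(LEAST n. h n = Some 0) = n"
      by (intro Least_equality) (auto simp: not_le [symmetric])
    moreover have "\<forall>j<n. h j \<noteq> None" using R by fastforce
    ultimately show ?L using R by (auto simp: mu_least_def)
  qed
  show ?case by (intro exI [of _ "prod_encode (7, e)"] allI) (simp only: 1 2)
qed

lemma semidec_conv: "semidecidable (\<lambda>z. conv (fst z) (fst (snd z)) (snd (snd z)))"
proof -
  obtain g :: "nat \<Rightarrow> nat \<times> nat \<times> nat" where g: "effective g" "range g = {(e, x, y). conv e x y}"
    by (rule conv_enumeration)
  have "conv (fst z) (fst (snd z)) (snd (snd z)) \<longleftrightarrow> z \<in> range g" for z
    unfolding g(2) by (simp add: case_prod_beta)
  moreover have "semidecidable (\<lambda>z. z \<in> range g)"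
  proof (rule semidecidableI)
    have "effective (\<lambda>z. g (snd z))" by (rule eff_comp [OF g(1)]) (intro eff)
    then show "effective (\<lambda>z. fst z = g (snd z))" by (intro eff)
  qed blast
  ultimately show ?thesis by simp
qed

lemma ce_set_iff: "ce_set A \<longleftrightarrow> semidecidable (\<lambda>x. x \<in> A)"
proof
  assume "ce_set A"
  then obtain f where "partial_recursive f" "A = dom f" by (auto simp: ce_set_def)
  then obtain e where e: "\<And>x y. conv e x y \<longleftrightarrow> f x = Some y" using conv_complete by blast
  have "x \<in> A \<longleftrightarrow> (\<exists>y. conv e x y)" for x
    using e \<open>A = dom f\<close> by auto
  moreover have "semidecidable (\<lambda>x. \<exists>y. conv e x y)"
  proof (rule semidec_Ex)
    show "semidecidable (\<lambda>z. conv e (fst z) (snd z))"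
      using semidec_comp [OF semidec_conv, of "\<lambda>z. (e, fst z, snd z)"] by (simp add: eff)
  qed
  ultimately show "semidecidable (\<lambda>x. x \<in> A)" by simp
next
  assume "semidecidable (\<lambda>x. x \<in> A)"
  then obtain Q where Q: "effective (\<lambda>z. Q (fst z) (snd z))" "\<And>x. x \<in> A \<longleftrightarrow> (\<exists>n::nat. Q x n)"
    by (auto simp: semidecidable_def)
  have "A = dom (\<lambda>x. if \<exists>n. Q x n then Some (LEAST n. Q x n) else None)"
    using Q(2) by (auto split: if_splits)
  with partial_recursive_Least [OF Q(1)] show "ce_set A" unfolding ce_set_def by blast
qed

lemma semidec_index:
  fixes P :: "nat \<Rightarrow> bool"
  assumes "semidecidable P"
  obtains e where "\<And>x. P x \<longleftrightarrow> (\<exists>y. conv e x y)"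
proof -
  have "ce_set {x. P x}" using assms by (simp add: ce_set_iff)
  then obtain f where f: "partial_recursive f" "{x. P x} = dom f" by (auto simp: ce_set_def)
  then obtain e where "\<And>x y. conv e x y \<longleftrightarrow> f x = Some y" using conv_complete by blast
  with f(2) show ?thesis by (intro that [of e]) blast
qed

lemma ceer_iff: "ceer E \<longleftrightarrow> equiv UNIV E \<and> semidecidable (\<lambda>p. p \<in> E)"
proof -
  have 1: "prod_encode p \<in> prod_encode ` E \<longleftrightarrow> p \<in> E" for p
    using inj_prod_encode by (simp add: inj_image_mem_iff)
  have 2: "x \<in> prod_encode ` E \<longleftrightarrow> prod_decode x \<in> E" for x
    using 1 [of "prod_decode x"] by simp
  have "semidecidable (\<lambda>x. x \<in> prod_encode ` E) \<longleftrightarrow> semidecidable (\<lambda>p. p \<in> E)"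
  proof
    assume "semidecidable (\<lambda>x. x \<in> prod_encode ` E)"
    then have "semidecidable (\<lambda>p. prod_encode p \<in> prod_encode ` E)"
      by (rule semidec_comp) (intro eff)
    then show "semidecidable (\<lambda>p. p \<in> E)" by (simp only: 1)
  next
    assume "semidecidable (\<lambda>p. p \<in> E)"
    then have "semidecidable (\<lambda>x. prod_decode x \<in> E)"
      by (rule semidec_comp) (intro eff)
    then show "semidecidable (\<lambda>x. x \<in> prod_encode ` E)" by (simp only: 2)
  qed
  then show ?thesis by (simp add: ceer_def ce_set_iff)
qed

section \<open>The priority construction\<close>

text \<open>
  The history of the construction is a list of events \<open>(k, p, c, d)\<close>, the latest first. Kind 0 makes
  \<open>c = d\<close> a marker of \<open>p\<close>. Kinds 1 and 2 merge the class represented by \<open>c\<close> into that of \<open>d\<close>, to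
  code \<open>U\<close> for \<open>p\<close> and to satisfy \<open>p\<close>, respectively; the latter cancels the markers of all \<open>r > p\<close>.
\<close>

type_synonym event = "nat \<times> nat \<times> nat \<times> nat"

text \<open>As the latest event stands first, \<open>foldr\<close> applies the oldest one first; the
  value is the current representative of the class of \<open>x\<close>.\<close>

definition merge :: "event list \<Rightarrow> nat \<Rightarrow> nat" where
  "merge L x = foldr (\<lambda>ev z. case ev of (k, p, c, d) \<Rightarrow> if z = c then d else z) L x"

definition markers :: "event list \<Rightarrow> nat \<Rightarrow> nat list" where
  "markers L p = foldr (\<lambda>ev M. case ev of (k, r, c, d) \<Rightarrow> if k = 0 \<and> r = p then M @ [c]
     else if k = 2 \<and> r < p then [] else M) L []"

text \<open>Stated through a bounded universal quantifier, the shape for which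
  \<open>eff_list_all\<close> proves effectiveness.\<close>

definition acted :: "event list \<Rightarrow> nat \<Rightarrow> bool" where
  "acted L p \<longleftrightarrow> \<not> (\<forall>ev\<in>set L. fst ev = 2 \<longrightarrow> fst (snd ev) \<noteq> p)"

lemma merge_simps [simp]:
  "merge [] x = x"
  "merge ((k, p, c, d) # L) x = (if merge L x = c then d else merge L x)"
  by (simp_all add: merge_def)

lemma markers_simps [simp]:
  "markers [] p = []"
  "markers ((k, r, c, d) # L) p = (if k = 0 \<and> r = p then markers L p @ [c]
     else if k = 2 \<and> r < p then [] else markers L p)"
  by (simp_all add: markers_def)

lemma acted_simps [simp]:
  "\<not> acted [] p"
  "acted ((k, r, c, d) # L) p \<longleftrightarrow> k = 2 \<and> r = p \<or> acted L p"
  by (auto simp: acted_def)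

lemma eff_merge: "effective L \<Longrightarrow> effective x \<Longrightarrow> effective (\<lambda>z. merge (L z) (x z))"
  unfolding merge_def by (intro eff)

lemma eff_markers:
  assumes "effective L" "effective p"
  shows "effective (\<lambda>z. markers (L z) (p z))"
proof -
  have p: "effective (\<lambda>z. p (fst z))" by (rule eff_comp [OF assms(2)]) (intro eff)
  show ?thesis unfolding markers_def by (intro eff assms p)
qed

lemma eff_acted:
  assumes "effective L" "effective p"
  shows "effective (\<lambda>z. acted (L z) (p z))"
proof -
  have p: "effective (\<lambda>z. p (fst z))" by (rule eff_comp [OF assms(2)]) (intro eff)
  show ?thesis unfolding acted_def by (intro eff assms p)
qed

text \<open>\<open>g\<close>, \<open>u\<close> and \<open>q\<close> enumerate the halting facts,
  \<open>U\<close>, and all \<open>Q k\<close> uniformly, so that every stage is decidable.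
  Non-universality of the \<open>Q k\<close> enters as \<open>not_red\<close>.\<close>

locale priority_construction =
  fixes R U :: "nat rel" and Q :: "nat \<Rightarrow> nat rel"
    and g :: "nat \<Rightarrow> nat \<times> nat \<times> nat" and u :: "nat \<Rightarrow> nat \<times> nat" and q :: "nat \<Rightarrow> nat \<times> nat \<times> nat"
  assumes R: "ceer R" and U: "equiv UNIV U"
    and g: "effective g" "range g = {(e, x, y). conv e x y}"
    and u: "effective u" "range u = U"
    and q: "effective q" "range q = {(k, x, y). (x, y) \<in> Q k}"
    and not_red: "\<not> U \<le>\<^sub>c Q k"
begin

text \<open>
  A number \<open>p = prod_encode (e, k)\<close> stands both for the requirement that program \<open>e\<close> does not reduce
  \<open>E\<close> to \<open>Q k\<close> (\<open>ext_ok\<close>) and for the lower ranked one that the domain of program \<open>e\<close> meets the class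
  of \<open>k\<close> (\<open>sat_ok\<close>).
\<close>

definition ext_ok :: "nat \<Rightarrow> nat \<Rightarrow> event list \<Rightarrow> bool" where
  "ext_ok s p L \<longleftrightarrow>
    (\<forall>a\<in>set (markers L p). \<exists>t<s. fst (g t) = fst (prod_decode p) \<and> fst (snd (g t)) = a) \<and>
    (\<forall>a\<in>set (markers L p). \<forall>b\<in>set (markers L p). \<forall>t<s. \<forall>t'<s.
      fst (g t) = fst (prod_decode p) \<and> fst (snd (g t)) = a \<and>
      fst (g t') = fst (prod_decode p) \<and> fst (snd (g t')) = b \<longrightarrow>
      (merge L a = merge L b) = (\<exists>r<s. q r = (snd (prod_decode p), snd (snd (g t)), snd (snd (g t')))))"

definition sat_ok :: "nat \<Rightarrow> nat \<Rightarrow> nat \<Rightarrow> event list \<Rightarrow> bool" where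
  "sat_ok s p t L \<longleftrightarrow> fst (g t) = fst (prod_decode p) \<and>
    fst (snd (g t)) < 2 * s \<and> snd (prod_decode p) < 2 * s \<and>
    odd (merge L (fst (snd (g t)))) \<and>
    (\<forall>r<Suc p. \<forall>a\<in>set (markers L r). merge L a \<noteq> merge L (fst (snd (g t)))) \<and> \<not> acted L p"

text \<open>A stage number codes its own task: a kind, a requirement, an index into an enumeration,
  and padding that makes every task recur beyond any bound. The new marker \<open>2 * s + 1\<close>
  is fresh, as all events before stage \<open>s\<close> concern numbers below
  \<open>2 * s\<close>.\<close>

definition step :: "nat \<Rightarrow> event list \<Rightarrow> event list" where
  "step s L = (case prod_decode s of (k, s') \<Rightarrow> case prod_decode s' of (p, s'') \<Rightarrow>
     case prod_decode s'' of (t, _) \<Rightarrow>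
     if k = 0 then if ext_ok s p L then (0, p, 2 * s + 1, 2 * s + 1) # L else L
     else if k = 1 then
       if fst (u t) < length (markers L p) \<and> snd (u t) < length (markers L p)
       then (1, p, merge L (hd (drop (fst (u t)) (markers L p))),
         merge L (hd (drop (snd (u t)) (markers L p)))) # L
       else L
     else if sat_ok s p t L
       then (2, p, merge L (fst (snd (g t))), merge L (snd (prod_decode p))) # L
     else L)"

definition log :: "nat \<Rightarrow> event list" where "log = rec_nat [] step"

lemma log_0 [simp]: "log 0 = []" and log_Suc: "log (Suc s) = step s (log s)"
  by (simp_all add: log_def)

lemmas eff_locale = eff_comp [OF g(1)] eff_comp [OF u(1)] eff_comp [OF q(1)]
  eff_merge eff_markers eff_acted

lemma eff_log: "effective log"
proof -
  have "effective (\<lambda>z. step (fst (snd z)) (snd (snd z)))"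
    unfolding step_def ext_ok_def sat_ok_def by (intro eff eff_locale)
  then show ?thesis unfolding log_def by (intro eff)
qed

definition h :: "nat \<Rightarrow> nat \<Rightarrow> nat" where "h s = merge (log s)"
definition A :: "nat \<Rightarrow> nat \<Rightarrow> nat list" where "A s p = markers (log s) p"

lemma g_conv: "g t = (e, x, y) \<Longrightarrow> conv e x y"
  using g(2) by (metis (mono_tags, lifting) case_prodD mem_Collect_eq rangeI)

lemma conv_g: "conv e x y \<Longrightarrow> \<exists>t. g t = (e, x, y)"
proof -
  assume "conv e x y"
  then have "(e, x, y) \<in> range g" by (simp add: g(2))
  then show ?thesis by (metis rangeE)
qed

lemma u_U: "u t \<in> U" using u(2) by blast

lemma U_u: "(x, y) \<in> U \<Longrightarrow> \<exists>t. u t = (x, y)"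
  using u(2) by (metis rangeE)

lemma q_Q: "q t = (k, x, y) \<Longrightarrow> (x, y) \<in> Q k"
  using q(2) by (metis (mono_tags, lifting) case_prodD mem_Collect_eq rangeI)

lemma Q_q: "(x, y) \<in> Q k \<Longrightarrow> \<exists>t. q t = (k, x, y)"
proof -
  assume "(x, y) \<in> Q k"
  then have "(k, x, y) \<in> range q" by (simp add: q(2))
  then show ?thesis by (metis rangeE)
qed

text \<open>This is \<open>sat_ok\<close> with the enumeration index replaced by a halting
  statement. Markers of \<open>r = p\<close> are protected too, because the irreducibility
  requirement of a number ranks above its satisfaction requirement.\<close>

definition sat_at :: "nat \<Rightarrow> nat \<Rightarrow> nat \<Rightarrow> bool" where
  "sat_at s p w \<longleftrightarrow> (\<exists>y. conv (fst (prod_decode p)) w y) \<and> w < 2 * s \<and> snd (prod_decode p) < 2 * s \<and>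
    odd (h s w) \<and> (\<forall>r\<le>p. \<forall>a\<in>set (A s r). h s a \<noteq> h s w) \<and> \<not> acted (log s) p"

lemma log_cases:
  obtains (same) "log (Suc s) = log s"
  | (extend) p where "ext_ok s p (log s)" "log (Suc s) = (0, p, 2 * s + 1, 2 * s + 1) # log s"
  | (code) p x y where "(x, y) \<in> U" "x < length (A s p)" "y < length (A s p)"
      "log (Suc s) = (1, p, h s (A s p ! x), h s (A s p ! y)) # log s"
  | (sat) p w where "sat_at s p w"
      "log (Suc s) = (2, p, h s w, h s (snd (prod_decode p))) # log s"
proof -
  obtain k p t n where s: "s = prod_encode (k, prod_encode (p, prod_encode (t, n)))"
    by (metis prod_decode_inverse surj_pair)
  have eq: "log (Suc s) = (if k = 0 then if ext_ok s p (log s) then (0, p, 2 * s + 1, 2 * s + 1) # log s else log s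
     else if k = 1 then
       if fst (u t) < length (A s p) \<and> snd (u t) < length (A s p)
       then (1, p, h s (hd (drop (fst (u t)) (A s p))), h s (hd (drop (snd (u t)) (A s p)))) # log s
       else log s
     else if sat_ok s p t (log s)
       then (2, p, h s (fst (snd (g t))), h s (snd (prod_decode p))) # log s
     else log s)"
    by (simp add: log_Suc step_def h_def A_def s)
  consider "log (Suc s) = log s" | "k = 0" "ext_ok s p (log s)"
    | "k = 1" "fst (u t) < length (A s p)" "snd (u t) < length (A s p)"
    | "k \<noteq> 0" "k \<noteq> 1" "sat_ok s p t (log s)"
    using eq by metis
  then show ?thesis
  proof cases
    case 2
    with eq show ?thesis by (intro extend) simp_all
  next
    case 3
    with eq u_U [of t] show ?thesis
      by (intro code [of "fst (u t)" "snd (u t)" p]) (simp_all add: hd_drop_conv_nth)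
  next
    case 4
    then have "conv (fst (prod_decode p)) (fst (snd (g t))) (snd (snd (g t)))"
      by (intro g_conv [of t]) (simp add: sat_ok_def prod_eq_iff)
    with 4 eq show ?thesis
      by (intro sat [of p "fst (snd (g t))"]) (auto simp: sat_ok_def sat_at_def h_def A_def less_Suc_eq_le)
  qed (rule same)
qed

lemma stage_exists:
  obtains s where "s \<ge> N" "prod_decode s = (k, prod_encode (p, prod_encode (t, N)))"
proof
  show "prod_encode (k, prod_encode (p, prod_encode (t, N))) \<ge> N"
    by (meson le_prod_encode_2 le_trans)
qed simp

lemma extends: "\<exists>s\<ge>N. ext_ok s p (log s) \<longrightarrow> A (Suc s) p = A s p @ [2 * s + 1]"
proof -
  obtain s where s: "s \<ge> N" "prod_decode s = (0, prod_encode (p, prod_encode (0, N)))"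
    by (rule stage_exists)
  then show ?thesis
    by (intro exI [of _ s]) (simp add: log_Suc A_def step_def)
qed

lemma codes:
  assumes "(x, y) \<in> U"
  shows "\<exists>s\<ge>N. x < length (A s p) \<and> y < length (A s p) \<longrightarrow> h (Suc s) (A s p ! x) = h (Suc s) (A s p ! y)"
proof -
  obtain t where t: "u t = (x, y)" using U_u [OF assms] by blast
  obtain s where s: "s \<ge> N" "prod_decode s = (1, prod_encode (p, prod_encode (t, N)))"
    by (rule stage_exists)
  then show ?thesis
    by (intro exI [of _ s]) (simp add: log_Suc A_def h_def step_def t hd_drop_conv_nth)
qed

lemma sats:
  assumes "conv (fst (prod_decode p)) w y"
  shows "\<exists>s\<ge>N. sat_at s p w \<longrightarrow> acted (log (Suc s)) p"
proof -
  obtain t where t: "g t = (fst (prod_decode p), w, y)" using conv_g [OF assms] by blast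
  obtain s where s: "s \<ge> N" "prod_decode s = (2, prod_encode (p, prod_encode (t, N)))"
    by (rule stage_exists)
  have "acted (log (Suc s)) p" if "sat_at s p w"
  proof -
    have "sat_ok s p t (log s)"
      using that t by (auto simp: sat_ok_def sat_at_def h_def A_def less_Suc_eq_le)
    then show ?thesis by (simp add: log_Suc step_def s(2))
  qed
  with s(1) show ?thesis by blast
qed

section \<open>Invariants of the stages\<close>

definition invariant :: "nat \<Rightarrow> bool" where
  "invariant s \<longleftrightarrow> (\<forall>x. even x \<longrightarrow> h s x = x) \<and> (\<forall>x. 2 * s \<le> x \<longrightarrow> h s x = x) \<and> (\<forall>x<2 * s. h s x < 2 * s) \<and>
    (\<forall>p. \<forall>a\<in>set (A s p). a < 2 * s \<and> odd (h s a)) \<and>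
    (\<forall>p r. p \<noteq> r \<longrightarrow> (\<forall>a\<in>set (A s p). \<forall>b\<in>set (A s r). h s a \<noteq> h s b)) \<and>
    (\<forall>p i j. i < length (A s p) \<and> j < length (A s p) \<and> h s (A s p ! i) = h s (A s p ! j) \<longrightarrow> (i, j) \<in> U)"

text \<open>Merges never displace an even representative, so even numbers stay fixed. Coding for one
  requirement leaves the markers of the others alone because their classes are disjoint; hence
  equalities among the markers of one requirement stay inside \<open>U\<close>.\<close>

lemma invariant: "invariant s"
proof (induction s)
  case 0
  show ?case by (simp add: invariant_def h_def A_def)
next
  case (Suc s)
  then have even: "even x \<Longrightarrow> h s x = x"
    and fresh: "2 * s \<le> x \<Longrightarrow> h s x = x"
    and bound: "x < 2 * s \<Longrightarrow> h s x < 2 * s"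
    and mark: "a \<in> set (A s p) \<Longrightarrow> a < 2 * s" "a \<in> set (A s p) \<Longrightarrow> odd (h s a)"
    and disj: "p \<noteq> r \<Longrightarrow> a \<in> set (A s p) \<Longrightarrow> b \<in> set (A s r) \<Longrightarrow> h s a \<noteq> h s b"
    and code: "i < length (A s p) \<Longrightarrow> j < length (A s p) \<Longrightarrow> h s (A s p ! i) = h s (A s p ! j) \<Longrightarrow>
      (i, j) \<in> U" for x a b p r i j
    unfolding invariant_def by blast+
  have bound': "h s x < 2 * Suc s" if "x < 2 * Suc s" for x
    using bound [of x] fresh [of x] that by (cases "x < 2 * s") auto
  have refl: "(x, x) \<in> U" and sym: "(x, y) \<in> U \<Longrightarrow> (y, x) \<in> U"
    and trans: "(x, y) \<in> U \<Longrightarrow> (y, z) \<in> U \<Longrightarrow> (x, z) \<in> U" for x y z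
    using U by (auto simp: equiv_def refl_on_def dest: symD transD)
  show ?case
  proof (cases rule: log_cases [of s])
    case same
    then have "h (Suc s) = h s" "A (Suc s) = A s"
      by (auto simp: h_def A_def fun_eq_iff)
    note eq = this
    show ?thesis
      unfolding invariant_def eq
    proof (intro conjI allI impI ballI)
      fix r a assume "a \<in> set (A s r)"
      from mark [OF this] show "a < 2 * Suc s" "odd (h s a)" by simp_all
    next
      fix x assume "2 * Suc s \<le> x"
      then show "h s x = x" by (intro fresh) simp
    next
      fix p r a b assume "p \<noteq> r" "a \<in> set (A s p)" "b \<in> set (A s r)"
      then show "h s a \<noteq> h s b" by (rule disj)
    next
      fix p i j
      assume "i < length (A s p) \<and> j < length (A s p) \<and> h s (A s p ! i) = h s (A s p ! j)"
      then show "(i, j) \<in> U" by (elim conjE) (rule code)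
    qed (fact even bound')+
  next
    case (extend p)
    then have hS: "h (Suc s) x = h s x"
      and AS: "A (Suc s) r = (if r = p then A s p @ [2 * s + 1] else A s r)" for x r
      by (auto simp: h_def A_def)
    have new: "h s (2 * s + 1) = 2 * s + 1" by (simp add: fresh)
    have old: "h s a < 2 * s" if "a \<in> set (A s r)" for a r
      using mark(1) [OF that] bound by blast
    show ?thesis
      unfolding invariant_def hS
    proof (intro conjI allI impI ballI)
      fix r i j
      assume *: "i < length (A (Suc s) r) \<and> j < length (A (Suc s) r) \<and>
        h s (A (Suc s) r ! i) = h s (A (Suc s) r ! j)"
      have old': "h s (A s r ! i) \<noteq> 2 * s + 1" if "i < length (A s r)" for i
        using old [of "A s r ! i" r] that by simp
      from * show "(i, j) \<in> U"
        using code [of i r j] old' [of i] old' [of j] new refl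
        by (auto simp: AS nth_append less_Suc_eq split: if_splits)
    next
      fix r r' a b
      assume "r \<noteq> r'" "a \<in> set (A (Suc s) r)" "b \<in> set (A (Suc s) r')"
      then show "h s a \<noteq> h s b"
        using disj [of r r' a b] new old [of a r] old [of b r'] by (auto simp: AS split: if_splits)
    next
      fix r a assume a: "a \<in> set (A (Suc s) r)"
      then show "odd (h s a)"
        using mark(2) [of a r] new by (auto simp: AS split: if_splits)
      show "a < 2 * Suc s"
        using a mark(1) [of a r] by (auto simp: AS split: if_splits)
    qed (use even fresh bound' in auto)
  next
    case (code p x y)
    define c d where "c = h s (A s p ! x)" and "d = h s (A s p ! y)"
    have hS: "h (Suc s) z = (if h s z = c then d else h s z)"
      and AS: "A (Suc s) r = A s r" for z r
      using code by (auto simp: h_def A_def c_def d_def)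
    have xy: "A s p ! x \<in> set (A s p)" "A s p ! y \<in> set (A s p)" using code by simp_all
    then have odd: "odd c" "odd d" and lt: "c < 2 * s" "d < 2 * s"
      using mark bound by (auto simp: c_def d_def)
    show ?thesis
      unfolding invariant_def AS
    proof (intro conjI allI impI ballI)
      fix r i j
      assume *: "i < length (A s r) \<and> j < length (A s r) \<and>
        h (Suc s) (A s r ! i) = h (Suc s) (A s r ! j)"
      show "(i, j) \<in> U"
      proof (cases "r = p")
        case True
        \<comment> \<open>A new equality between markers passes through the merged classes: their
          indices are related to \<open>x\<close> and \<open>y\<close> by the old code, and
          \<open>x\<close> to \<open>y\<close> by the event.\<close>
        have "(i', x) \<in> U" if "i' < length (A s p)" "h s (A s p ! i') = c" for i'
          using Suc that code(2) unfolding invariant_def c_def by blast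
        moreover have "(i', y) \<in> U" if "i' < length (A s p)" "h s (A s p ! i') = d" for i'
          using Suc that code(3) unfolding invariant_def d_def by blast
        moreover have "(i, j) \<in> U" if "h s (A s r ! i) = h s (A s r ! j)"
          using Suc that * unfolding invariant_def by blast
        ultimately show ?thesis
          using * True code(1) unfolding hS by (metis sym trans)
      next
        case False
        have "h s (A s r ! i') \<noteq> c" if "i' < length (A s r)" for i'
          using disj [OF False, of "A s r ! i'"] xy(1) that by (simp add: c_def)
        with * have "h s (A s r ! i) = h s (A s r ! j)" by (auto simp: hS)
        with * Suc show ?thesis unfolding invariant_def by blast
      qed
    next
      fix r r' a b
      assume *: "r \<noteq> r'" "a \<in> set (A s r)" "b \<in> set (A s r')"
      have "h s a = c \<or> h s a = d \<Longrightarrow> r = p" "h s b = c \<or> h s b = d \<Longrightarrow> r' = p"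
        using disj [OF _ *(2)] disj [OF _ *(3)] xy by (auto simp: c_def d_def)
      with * disj [OF *] show "h (Suc s) a \<noteq> h (Suc s) b" by (auto simp: hS)
    next
      fix r a assume a: "a \<in> set (A s r)"
      then show "odd (h (Suc s) a)" using mark(2) odd by (auto simp: hS)
      show "a < 2 * Suc s" using mark(1) [OF a] by simp
    qed (use even fresh bound' odd lt in \<open>auto simp: hS\<close>)
  next
    case (sat p w)
    define c d where "c = h s w" and "d = h s (snd (prod_decode p))"
    have hS: "h (Suc s) z = (if h s z = c then d else h s z)"
      and AS: "A (Suc s) r = (if p < r then [] else A s r)" for z r
      using sat by (auto simp: h_def A_def c_def d_def)
    have odd: "odd c" and lt: "c < 2 * s" "d < 2 * s"
      using sat bound by (auto simp: c_def d_def sat_at_def)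
    \<comment> \<open>Surviving markers belong to some \<open>r \<le> p\<close>, and
      \<open>sat_at\<close> keeps their classes apart from that of \<open>w\<close>. Their
      representatives are therefore unchanged.\<close>
    have h_old: "a \<in> set (A s r)" "h (Suc s) a = h s a" if a: "a \<in> set (A (Suc s) r)" for a r
    proof -
      from a have r: "r \<le> p" and a': "a \<in> set (A s r)" by (auto simp: AS split: if_splits)
      then have "h s a \<noteq> c" using sat(1) by (auto simp: sat_at_def c_def)
      with a' show "a \<in> set (A s r)" "h (Suc s) a = h s a" by (simp_all add: hS)
    qed
    show ?thesis
      unfolding invariant_def
    proof (intro conjI allI impI ballI)
      fix r i j
      assume *: "i < length (A (Suc s) r) \<and> j < length (A (Suc s) r) \<and>
        h (Suc s) (A (Suc s) r ! i) = h (Suc s) (A (Suc s) r ! j)"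
      then have "h s (A (Suc s) r ! i) = h s (A (Suc s) r ! j)"
        using h_old(2) [of "A (Suc s) r ! i" r] h_old(2) [of "A (Suc s) r ! j" r] by simp
      moreover have "A (Suc s) r = A s r" using * by (auto simp: AS)
      ultimately show "(i, j) \<in> U" using * Suc unfolding invariant_def by metis
    next
      fix r r' a b
      assume "r \<noteq> r'" "a \<in> set (A (Suc s) r)" "b \<in> set (A (Suc s) r')"
      then show "h (Suc s) a \<noteq> h (Suc s) b" using disj h_old by metis
    next
      fix r a assume a: "a \<in> set (A (Suc s) r)"
      then show "odd (h (Suc s) a)" using mark(2) h_old by metis
      show "a < 2 * Suc s" using mark(1) [OF h_old(1) [OF a]] by simp
    qed (use even fresh bound' odd lt in \<open>auto simp: hS\<close>)
  qed
qed

lemma h_even: "even x \<Longrightarrow> h s x = x"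
  and marker_odd: "a \<in> set (A s p) \<Longrightarrow> odd (h s a)"
  and marker_code: "i < length (A s p) \<Longrightarrow> j < length (A s p) \<Longrightarrow>
    h s (A s p ! i) = h s (A s p ! j) \<Longrightarrow> (i, j) \<in> U"
  using invariant [of s] unfolding invariant_def by blast+

lemma h_Suc: "h (Suc s) x = h (Suc s) y" if "h s x = h s y"
  by (cases rule: log_cases [of s]) (use that in \<open>auto simp: h_def\<close>)

lemma h_mono: "s \<le> s' \<Longrightarrow> h s x = h s y \<Longrightarrow> h s' x = h s' y"
  by (induction s' rule: dec_induct) (auto intro: h_Suc)

text \<open>Only odd representatives are replaced: coding merges classes of markers, and
  satisfaction demands \<open>odd (h s w)\<close>. A class that has reached an even number has its
  final representative.\<close>

lemma h_even_Suc: "h (Suc s) x = h s x" if "even (h s x)"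
proof (cases rule: log_cases [of s])
  case (code p y z)
  then have "odd (h s (A s p ! y))" by (intro marker_odd [of _ s p]) simp
  then show ?thesis using that code by (auto simp: h_def)
next
  case (sat p w)
  then have "odd (h s w)" by (simp add: sat_at_def)
  then show ?thesis using that sat(2) by (auto simp: h_def)
qed (use that in \<open>simp_all add: h_def\<close>)

lemma h_even_mono: "s \<le> s' \<Longrightarrow> even (h s x) \<Longrightarrow> h s' x = h s x"
  by (induction s' rule: dec_induct) (auto simp: h_even_Suc)

text \<open>The stages only merge classes by hand; collapses of even numbers caused by \<open>R\<close> are added at
  the end, so that the stages need not approximate \<open>R\<close>.\<close>

definition E_at :: "nat \<Rightarrow> nat \<Rightarrow> nat \<Rightarrow> bool" where
  "E_at s x y \<longleftrightarrow> h s x = h s y \<or> even (h s x) \<and> even (h s y) \<and> (h s x div 2, h s y div 2) \<in> R"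

definition E :: "nat rel" where "E = {(x, y). \<exists>s. E_at s x y}"

lemma R_equiv: "(x, x) \<in> R" "(x, y) \<in> R \<Longrightarrow> (y, x) \<in> R" "(x, y) \<in> R \<Longrightarrow> (y, z) \<in> R \<Longrightarrow> (x, z) \<in> R"
  using R by (auto simp: ceer_def equiv_def refl_on_def dest: symD transD)

lemma E_at_mono: "E_at s x y \<Longrightarrow> s \<le> s' \<Longrightarrow> E_at s' x y"
  unfolding E_at_def
proof (elim disjE conjE)
  assume "s \<le> s'" "h s x = h s y"
  then show "h s' x = h s' y \<or> even (h s' x) \<and> even (h s' y) \<and> (h s' x div 2, h s' y div 2) \<in> R"
    using h_mono by blast
next
  assume "s \<le> s'" "even (h s x)" "even (h s y)" "(h s x div 2, h s y div 2) \<in> R"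
  then show "h s' x = h s' y \<or> even (h s' x) \<and> even (h s' y) \<and> (h s' x div 2, h s' y div 2) \<in> R"
    using h_even_mono by simp
qed

lemma E_at_sym: "E_at s x y \<Longrightarrow> E_at s y x"
  unfolding E_at_def using R_equiv(2) by auto

lemma E_at_trans: "E_at s x y \<Longrightarrow> E_at s y z \<Longrightarrow> E_at s x z"
  unfolding E_at_def using R_equiv(3) by auto

lemma E_equiv: "equiv UNIV E"
proof (rule equivI)
  show "E \<subseteq> UNIV \<times> UNIV" by simp
  show "refl_on UNIV E" by (auto simp: E_def E_at_def refl_on_def)
  show "sym E" using E_at_sym by (auto simp: sym_def E_def)
  show "trans E"
  proof (rule transI)
    fix x y z assume "(x, y) \<in> E" "(y, z) \<in> E"
    then obtain s s' where "E_at s x y" "E_at s' y z" by (auto simp: E_def)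
    then have "E_at (max s s') x y" "E_at (max s s') y z" by (auto intro: E_at_mono)
    then show "(x, z) \<in> E" unfolding E_def using E_at_trans by blast
  qed
qed

lemma E_h: "h s x = h s y \<Longrightarrow> (x, y) \<in> E"
  unfolding E_def E_at_def by blast

lemma E_even: "even (h s x) \<Longrightarrow> (x, h s x) \<in> E"
  by (rule E_h [of s]) (simp add: h_even)

text \<open>Even numbers are their own representatives at every stage, so identifications among them
  come from \<open>R\<close> alone.\<close>

lemma E_iff_R: "(2 * x, 2 * y) \<in> E \<longleftrightarrow> (x, y) \<in> R"
  unfolding E_def E_at_def by (auto simp: h_even R_equiv(1))

lemma eff_h: "effective s \<Longrightarrow> effective x \<Longrightarrow> effective (\<lambda>z. h (s z) (x z))"
  unfolding h_def by (intro eff_merge eff_comp [OF eff_log])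

lemma eff_A: "effective s \<Longrightarrow> effective p \<Longrightarrow> effective (\<lambda>z. A (s z) (p z))"
  unfolding A_def by (intro eff_markers eff_comp [OF eff_log])

lemma ceer_E: "ceer E"
proof -
  have "semidecidable (\<lambda>z. z \<in> R)" using R by (simp add: ceer_iff)
  then have R': "semidecidable (\<lambda>z. (h (snd z) (fst (fst z)) div 2, h (snd z) (snd (fst z)) div 2) \<in> R)"
    by (rule semidec_comp) (intro eff eff_h)
  have "semidecidable (\<lambda>p. \<exists>s. E_at s (fst p) (snd p))"
    unfolding E_at_def by (intro semidec R'; intro semidec_eff eff eff_h)
  then show ?thesis unfolding ceer_iff using E_equiv by (simp add: E_def case_prod_beta)
qed

section \<open>Finite injury and irreducibility\<close>

lemma acted_mono: "s \<le> s' \<Longrightarrow> acted (log s) p \<Longrightarrow> acted (log s') p"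
proof (induction s' rule: dec_induct)
  case (step n)
  then show ?case by (cases rule: log_cases [of n]) auto
qed

text \<open>Each satisfaction requirement acts at most once, so injuries to \<open>p\<close> come to an end.\<close>

lemma quiet_exists:
  obtains s0 where "\<And>s r. s \<ge> s0 \<Longrightarrow> r < p \<Longrightarrow> acted (log (Suc s)) r \<longleftrightarrow> acted (log s) r"
proof -
  have "eventually (\<lambda>s. acted (log s) r \<longleftrightarrow> (\<exists>s. acted (log s) r)) sequentially" for r
    using acted_mono unfolding eventually_sequentially by meson
  then have "eventually (\<lambda>s. \<forall>r\<in>{..<p}. acted (log s) r \<longleftrightarrow> (\<exists>s. acted (log s) r)) sequentially"
    by (intro eventually_ball_finite) auto
  then obtain s0 where "\<And>s r. s \<ge> s0 \<Longrightarrow> r < p \<Longrightarrow> acted (log s) r \<longleftrightarrow> (\<exists>s. acted (log s) r)"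
    unfolding eventually_sequentially by blast
  then show ?thesis by (intro that [of s0]) (metis le_SucI)
qed

context
  fixes p e k s0
  assumes p: "p = prod_encode (e, k)"
    and quiet: "\<And>s r. s \<ge> s0 \<Longrightarrow> r < p \<Longrightarrow> acted (log (Suc s)) r \<longleftrightarrow> acted (log s) r"
begin

text \<open>Cancelling the markers of \<open>p\<close> takes a first action of some
  \<open>r < p\<close>, which \<open>quiet\<close> excludes from \<open>s0\<close> on.\<close>

lemma A_step:
  assumes "s \<ge> s0"
  shows "A (Suc s) p = A s p \<or> ext_ok s p (log s) \<and> A (Suc s) p = A s p @ [2 * s + 1]"
proof (cases rule: log_cases [of s])
  case (sat r w)
  then have "\<not> r < p" using quiet [OF assms, of r] by (auto simp: sat_at_def)
  with sat(2) show ?thesis by (simp add: A_def)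
next
  case (extend r)
  then show ?thesis by (cases "r = p") (simp_all add: A_def)
qed (simp_all add: A_def)

lemma A_prefix:
  assumes "s0 \<le> s" "s \<le> s'"
  shows "\<exists>ys. A s' p = A s p @ ys"
  using assms(2)
proof (induction s' rule: dec_induct)
  case (step n)
  then show ?case using A_step [of n] assms(1) by fastforce
qed simp

lemma A_nth:
  assumes "s0 \<le> s" "s \<le> s'" "i < length (A s p)"
  shows "i < length (A s' p)" "A s' p ! i = A s p ! i"
  using A_prefix [OF assms(1,2)] assms(3) by (auto simp: nth_append)

lemma ext_okD:
  assumes "ext_ok s p (log s)" "a \<in> set (A s p)"
  shows "\<exists>v. conv e a v"
proof -
  obtain t where "fst (g t) = e" "fst (snd (g t)) = a"
    using assms by (auto simp: ext_ok_def A_def p)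
  then show ?thesis by (intro exI g_conv [of t]) (simp add: prod_eq_iff)
qed

lemma ext_ok_iff:
  assumes "ext_ok s p (log s)" "a \<in> set (A s p)" "b \<in> set (A s p)"
    "g t = (e, a, v)" "g t' = (e, b, v')" "t < s" "t' < s"
  shows "h s a = h s b \<longleftrightarrow> (\<exists>r<s. q r = (k, v, v'))"
proof -
  have "\<forall>a\<in>set (A s p). \<forall>b\<in>set (A s p). \<forall>t<s. \<forall>t'<s.
      fst (g t) = e \<and> fst (snd (g t)) = a \<and> fst (g t') = e \<and> fst (snd (g t')) = b \<longrightarrow>
      (h s a = h s b) = (\<exists>r<s. q r = (k, snd (snd (g t)), snd (snd (g t'))))"
    using assms(1) unfolding ext_ok_def h_def A_def p by simp
  from this [rule_format, of a b t t'] assms(2-) show ?thesis by simp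
qed

text \<open>An even representative would persist to a later stage at which the number is still a
  marker, against \<open>marker_odd\<close>.\<close>

lemma marker_stays_odd:
  assumes "s0 \<le> s" "i < length (A s p)"
  shows "odd (h s' (A s p ! i))"
proof
  assume ev: "even (h s' (A s p ! i))"
  have "i < length (A (max s s') p)" and "A (max s s') p ! i = A s p ! i"
    using A_nth [OF assms(1) _ assms(2), of "max s s'"] by simp_all
  then have "odd (h (max s s') (A s p ! i))" using marker_odd by (metis nth_mem)
  then show False using h_even_mono [OF _ ev, of "max s s'"] ev by simp
qed

text \<open>The clause of \<open>E_at\<close> that refers to \<open>R\<close> does not apply to
  lasting markers, as their representatives stay odd. Their equivalence thus becomes visible in the
  stages, where \<open>ext_ok\<close> can test it.\<close>

lemma E_markers:
  assumes "s0 \<le> s" "i < length (A s p)" "j < length (A s p)"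
  shows "(A s p ! i, A s p ! j) \<in> E \<longleftrightarrow> (\<exists>s'. h s' (A s p ! i) = h s' (A s p ! j))"
  using marker_stays_odd [OF assms(1,2)] unfolding E_def E_at_def by blast

text \<open>Had \<open>p\<close> infinitely many extensions, its markers would copy \<open>U\<close> into \<open>E\<close> and the \<open>e\<close>-th
  program would carry this copy into \<open>Q k\<close>.\<close>

lemma length_bounded: "\<exists>m. \<forall>s\<ge>s0. length (A s p) \<le> m"
proof (rule ccontr)
  assume "\<not> ?thesis"
  then have unbounded: "\<exists>s\<ge>s0. m < length (A s p)" for m by (metis not_le)
  have extend: "\<exists>s\<ge>N. ext_ok s p (log s)" if "N \<ge> s0" for N
  proof (rule ccontr)
    assume no: "\<not> ?thesis"
    have "A s p = A N p" if "s \<ge> N" for s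
      using that
    proof (induction s rule: dec_induct)
      case (step n)
      then show ?case using A_step [of n] no \<open>N \<ge> s0\<close> by auto
    qed simp
    moreover have "length (A s p) \<le> length (A N p)" if "s0 \<le> s" "s \<le> N" for s
      using A_prefix [OF that] by auto
    ultimately have "length (A s p) \<le> length (A N p)" if "s0 \<le> s" for s
      using that by (metis nat_le_linear order_refl)
    then show False using unbounded [of "length (A N p)"] by (metis not_le)
  qed
  \<comment> \<open>\<open>P x v\<close> makes \<open>v\<close> an output of program
    \<open>e\<close> on the \<open>x\<close>-th marker, which by \<open>A_nth\<close> is the same at
    every stage from \<open>s0\<close> on at which it exists.\<close>
  define P where "P x v \<longleftrightarrow> (\<exists>s. s \<ge> s0 \<and> x < length (A s p) \<and> conv e (hd (drop x (A s p))) v)" for x v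
  have c: "semidecidable (\<lambda>z. conv e (hd (drop (fst (fst z)) (A (snd z) p))) (snd (fst z)))"
    by (rule semidec_comp [OF semidec_conv, of "\<lambda>z. (e, hd (drop (fst (fst z)) (A (snd z) p)), snd (fst z))",
      unfolded fst_conv snd_conv]) (intro eff eff_A)
  have "semidecidable (\<lambda>z. P (fst z) (snd z))"
    unfolding P_def by (intro semidec c; intro semidec_eff eff eff_A)
  moreover have "\<exists>v. P x v" for x
  proof -
    obtain s where s: "s \<ge> s0" "x < length (A s p)" using unbounded by blast
    obtain s' where s': "s' \<ge> s" "ext_ok s' p (log s')" using extend [OF s(1)] by blast
    have x: "x < length (A s' p)" using A_nth [OF s(1) s'(1) s(2)] by simp
    then obtain v where "conv e (A s' p ! x) v"
      using ext_okD [OF s'(2), of "A s' p ! x"] by auto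
    then show ?thesis using s s' x unfolding P_def by (metis hd_drop_conv_nth le_trans)
  qed
  ultimately obtain f where f: "computable f" "\<And>x. P x (f x)"
    by (rule semidec_select) blast
  have "(x, y) \<in> U \<longleftrightarrow> (f x, f y) \<in> Q k" for x y
  proof -
    have "\<exists>s t. s \<ge> s0 \<and> x < length (A s p) \<and> g t = (e, A s p ! x, f x)" for x
      using f(2) [of x] conv_g unfolding P_def by (metis hd_drop_conv_nth)
    then obtain s t s' t' where s: "s \<ge> s0" "x < length (A s p)" "g t = (e, A s p ! x, f x)"
      and s': "s' \<ge> s0" "y < length (A s' p)" "g t' = (e, A s' p ! y, f y)"
      by metis
    define a b where "a = A s p ! x" and "b = A s' p ! y"
    have ab: "x < length (A n p)" "A n p ! x = a" "y < length (A n p)" "A n p ! y = b"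
      if "n \<ge> max s s'" for n
      using A_nth [OF s(1) _ s(2), of n] A_nth [OF s'(1) _ s'(2), of n] that
      by (simp_all add: a_def b_def)
    \<comment> \<open>Equality of representatives and enumeration into \<open>Q k\<close> are both
      monotone in the stage, so agreement at arbitrarily late stages carries over to the
      limit.\<close>
    have good: "\<exists>n\<ge>N. n \<ge> max s s' \<and> (h n a = h n b \<longleftrightarrow> (\<exists>r<n. q r = (k, f x, f y)))" for N
    proof -
      define N' where "N' = Max {N, s, s', Suc t, Suc t', s0}"
      have N': "N' \<ge> x" if "x \<in> {N, s, s', Suc t, Suc t', s0}" for x
        unfolding N'_def using that by (intro Max_ge) auto
      then obtain n where n: "n \<ge> N'" "ext_ok n p (log n)"
        using extend [of N'] by blast
      with N' [of N] N' [of s] N' [of s'] N' [of "Suc t"] N' [of "Suc t'"] have "n \<ge> max s s'" "t < n" "t' < n" "n \<ge> N" by simp_all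
      moreover have "a \<in> set (A n p)" "b \<in> set (A n p)"
        using ab [OF \<open>n \<ge> max s s'\<close>] by (metis nth_mem)+
      ultimately show ?thesis
        using ext_ok_iff [OF n(2)] s(3) s'(3) unfolding a_def b_def by blast
    qed
    show ?thesis
    proof
      assume "(x, y) \<in> U"
      then obtain m where m: "m \<ge> max s s'"
        "x < length (A m p) \<and> y < length (A m p) \<longrightarrow> h (Suc m) (A m p ! x) = h (Suc m) (A m p ! y)"
        using codes by blast
      then have "h (Suc m) a = h (Suc m) b" using ab by simp
      moreover obtain n where "n \<ge> Suc m" "h n a = h n b \<longleftrightarrow> (\<exists>r<n. q r = (k, f x, f y))"
        using good by blast
      ultimately show "(f x, f y) \<in> Q k" using h_mono q_Q by blast
    next
      assume "(f x, f y) \<in> Q k"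
      then obtain r where "q r = (k, f x, f y)" using Q_q by blast
      moreover obtain n where "n \<ge> Suc r" "n \<ge> max s s'"
        "h n a = h n b \<longleftrightarrow> (\<exists>r<n. q r = (k, f x, f y))"
        using good by blast
      ultimately have "h n a = h n b" by (metis Suc_le_lessD)
      then show "(x, y) \<in> U"
        using marker_code [of x n p y] ab [OF \<open>n \<ge> max s s'\<close>] by simp
    qed
  qed
  with f(1) have "U \<le>\<^sub>c Q k" by (auto simp: reducible_def reduction_def)
  with not_red show False by blast
qed

lemma A_stable: "\<exists>s1\<ge>s0. \<forall>s\<ge>s1. A s p = A s1 p"
proof -
  obtain m where m: "\<And>s. s \<ge> s0 \<Longrightarrow> length (A s p) \<le> m" using length_bounded by blast
  let ?l = "\<lambda>l. \<exists>s\<ge>s0. length (A s p) = l"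
  have "?l (GREATEST l. ?l l)"
    by (rule GreatestI_ex_nat [of ?l m]) (use m in auto)
  then obtain s1 where s1: "s1 \<ge> s0" "length (A s1 p) = (GREATEST l. ?l l)" by blast
  have "A s p = A s1 p" if s: "s \<ge> s1" for s
  proof -
    obtain ys where ys: "A s p = A s1 p @ ys" using A_prefix [OF s1(1) s] by blast
    have "length (A s p) \<le> length (A s1 p)"
      unfolding s1(2) by (rule Greatest_le_nat [of ?l _ m]) (use m s1 s in \<open>auto intro!: exI [of _ s]\<close>)
    with ys show ?thesis by simp
  qed
  with s1(1) show ?thesis by blast
qed

text \<open>For a true reduction, all computations and identifications concerning the finitely many
  limit markers are eventually settled. Then \<open>ext_ok\<close> holds at a later stage devoted to
  \<open>p\<close>, which adds a marker to a list that was already final.\<close>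

lemma not_reduction_program:
  assumes "\<And>x y. conv e x y \<longleftrightarrow> f x = y"
  shows "\<not> reduction f E (Q k)"
proof
  assume red: "reduction f E (Q k)"
  obtain s1 where s1: "s1 \<ge> s0" "\<And>s. s \<ge> s1 \<Longrightarrow> A s p = A s1 p" using A_stable by blast
  define M where "M = set (A s1 p)"
  have "\<exists>t. g t = (e, a, f a)" for a using assms conv_g by blast
  then have 1: "eventually (\<lambda>s. \<exists>t<s. g t = (e, a, f a)) sequentially" for a
    unfolding eventually_sequentially by (meson Suc_le_lessD)
  \<comment> \<open>An equivalence shows up in both approximations from some stage on, an
    inequivalence in neither at any stage.\<close>
  have 2: "eventually (\<lambda>s. h s a = h s b \<longleftrightarrow> (\<exists>r<s. q r = (k, f a, f b))) sequentially"
    if ab: "a \<in> M" "b \<in> M" for a b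
  proof (cases "(a, b) \<in> E")
    case True
    obtain i j where "i < length (A s1 p)" "j < length (A s1 p)" "a = A s1 p ! i" "b = A s1 p ! j"
      using ab unfolding M_def in_set_conv_nth by metis
    with True obtain s where s: "h s a = h s b"
      using E_markers [OF s1(1)] by metis
    moreover obtain r where "q r = (k, f a, f b)"
      using True red Q_q unfolding reduction_def by blast
    ultimately have "h n a = h n b \<and> (\<exists>r<n. q r = (k, f a, f b))" if "n \<ge> max s (Suc r)" for n
      using that h_mono [of s n a b] by (auto simp: Suc_le_eq)
    then show ?thesis unfolding eventually_sequentially by blast
  next
    case False
    then have "h s a \<noteq> h s b" "\<not> (\<exists>r. q r = (k, f a, f b))" for s
      using red q_Q E_h unfolding reduction_def by blast+
    then show ?thesis by auto
  qed
  have "eventually (\<lambda>s. s \<ge> s1 \<and> (\<forall>a\<in>M. (\<exists>t<s. g t = (e, a, f a)) \<and>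
      (\<forall>b\<in>M. h s a = h s b \<longleftrightarrow> (\<exists>r<s. q r = (k, f a, f b))))) sequentially"
    using 1 2 by (intro eventually_conj eventually_ball_finite ballI eventually_ge_at_top)
      (auto simp: M_def)
  then obtain N where N: "\<And>s. s \<ge> N \<Longrightarrow> s \<ge> s1 \<and> (\<forall>a\<in>M. (\<exists>t<s. g t = (e, a, f a)) \<and>
      (\<forall>b\<in>M. h s a = h s b \<longleftrightarrow> (\<exists>r<s. q r = (k, f a, f b))))"
    unfolding eventually_sequentially by blast
  obtain s where s: "s \<ge> N" "ext_ok s p (log s) \<longrightarrow> A (Suc s) p = A s p @ [2 * s + 1]"
    using extends by blast
  have val: "snd (snd (g t)) = f (fst (snd (g t)))" if "fst (g t) = e" for t
    using g_conv [of t] assms that by (metis prod.collapse)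
  have AM: "set (markers (log s) p) = M"
    using s1(2) [of s] N [OF s(1)] by (simp add: M_def A_def)
  have "ext_ok s p (log s)"
    unfolding ext_ok_def AM
  proof (intro conjI ballI allI impI)
    fix a assume "a \<in> M"
    then show "\<exists>t<s. fst (g t) = fst (prod_decode p) \<and> fst (snd (g t)) = a"
      using N [OF s(1)] p by fastforce
  next
    fix a b t t'
    assume ab: "a \<in> M" "b \<in> M"
      and *: "fst (g t) = fst (prod_decode p) \<and> fst (snd (g t)) = a \<and>
       fst (g t') = fst (prod_decode p) \<and> fst (snd (g t')) = b"
    have "snd (snd (g t)) = f a" "snd (snd (g t')) = f b" "snd (prod_decode p) = k"
      using val [of t] val [of t'] * p by auto
    then show "(merge (log s) a = merge (log s) b) =
       (\<exists>r<s. q r = (snd (prod_decode p), snd (snd (g t)), snd (snd (g t'))))"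
      using N [OF s(1)] ab unfolding h_def by auto
  qed
  then have "length (A (Suc s) p) > length (A s p)" using s(2) by simp
  moreover have "A (Suc s) p = A s p" using s1(2) N [OF s(1)] by (metis le_SucI)
  ultimately show False by simp
qed

end

lemma E_not_reducible: "\<not> E \<le>\<^sub>c Q k"
proof
  assume "E \<le>\<^sub>c Q k"
  then obtain f where f: "reduction f E (Q k)" by (auto simp: reducible_def)
  then obtain e where e: "\<And>x y. conv e x y \<longleftrightarrow> f x = y"
    using conv_complete [of "\<lambda>x. Some (f x)"] by (auto simp: reduction_def computable_def)
  obtain s0 where "\<And>s r. s \<ge> s0 \<Longrightarrow> r < prod_encode (e, k) \<Longrightarrow> acted (log (Suc s)) r \<longleftrightarrow> acted (log s) r"
    using quiet_exists by blast
  from not_reduction_program [OF refl this e] f show False by blast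
qed

lemma A_eventually: "\<exists>M. finite M \<and> eventually (\<lambda>s. set (A s p) = M) sequentially"
proof -
  obtain s0 where s0: "\<And>s r. s \<ge> s0 \<Longrightarrow> r < p \<Longrightarrow> acted (log (Suc s)) r \<longleftrightarrow> acted (log s) r"
    using quiet_exists by blast
  have "p = prod_encode (fst (prod_decode p), snd (prod_decode p))" by simp
  from A_stable [OF this s0] obtain s1 where "\<And>s. s \<ge> s1 \<Longrightarrow> A s p = A s1 p" by blast
  then have "\<forall>s\<ge>s1. set (A s p) = set (A s1 p)" by metis
  then show ?thesis unfolding eventually_sequentially by blast
qed

section \<open>The satisfaction requirements\<close>

lemma acted_sound:
  "acted (log s) p \<Longrightarrow> \<exists>w y. conv (fst (prod_decode p)) w y \<and> (w, snd (prod_decode p)) \<in> E"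
proof (induction s)
  case (Suc s)
  show ?case
  proof (cases rule: log_cases [of s])
    case (sat r w)
    show ?thesis
    proof (cases "acted (log s) p")
      case False
      with sat Suc.prems have "r = p" by simp
      moreover have "(w, snd (prod_decode r)) \<in> E"
        by (rule E_h [of "Suc s"]) (simp add: h_def sat(2))
      ultimately show ?thesis using sat(1) by (auto simp: sat_at_def)
    qed (rule Suc.IH)
  qed (use Suc in auto)
qed simp

text \<open>Take \<open>w\<close> outside the classes of even numbers and of the limit markers of
  all \<open>r \<le> p\<close>. Equal representatives imply equivalence in \<open>E\<close>, so no
  late stage gives \<open>w\<close> an even representative or that of a protected marker. The
  requirement therefore acts at its next turn unless it has acted before.\<close>

lemma E_dichotomy:
  assumes "semidecidable (\<lambda>x. x \<in> W)"
    and not_covered: "\<And>M. finite M \<Longrightarrow> \<exists>w\<in>W. (\<forall>x. (w, 2 * x) \<notin> E) \<and> (\<forall>a\<in>M. (w, a) \<notin> E)"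
  shows "\<exists>w\<in>W. (w, j) \<in> E"
proof -
  obtain e where e: "\<And>x. x \<in> W \<longleftrightarrow> (\<exists>y. conv e x y)"
    using semidec_index [OF assms(1)] by blast
  define p where "p = prod_encode (e, j)"
  obtain M where M: "\<And>r. finite (M r)" "\<And>r. eventually (\<lambda>s. set (A s r) = M r) sequentially"
    using A_eventually by metis
  obtain w where w: "w \<in> W" "\<And>x. (w, 2 * x) \<notin> E" "\<And>r a. r \<le> p \<Longrightarrow> a \<in> M r \<Longrightarrow> (w, a) \<notin> E"
    using not_covered [of "\<Union>r\<le>p. M r"] M(1) by auto
  have "eventually (\<lambda>s. w < s \<and> j < s \<and> (\<forall>r\<in>{..p}. set (A s r) = M r)) sequentially"
    using M(2) by (intro eventually_conj eventually_ball_finite eventually_gt_at_top) auto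
  then obtain N where N: "\<And>s. s \<ge> N \<Longrightarrow> w < s \<and> j < s \<and> (\<forall>r\<in>{..p}. set (A s r) = M r)"
    unfolding eventually_sequentially by blast
  obtain y where "conv (fst (prod_decode p)) w y" using w(1) e by (auto simp: p_def)
  then obtain s where s: "s \<ge> N" "sat_at s p w \<longrightarrow> acted (log (Suc s)) p"
    using sats by blast
  have "\<exists>s. acted (log s) p"
  proof (cases "acted (log s) p")
    case False
    have "odd (h s w)"
      using E_even [of s w] w(2) [of "h s w div 2"] by (metis even_two_times_div_two)
    moreover have "h s a \<noteq> h s w" if "r \<le> p" "a \<in> set (A s r)" for r a
      using w(3) [OF that(1), of a] E_h [of s w a] N [OF s(1)] that by auto
    ultimately have "sat_at s p w"
      using False N [OF s(1)] e w(1) by (auto simp: sat_at_def p_def)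
    with s(2) show ?thesis by blast
  qed blast
  then show ?thesis using acted_sound [of _ p] e by (auto simp: p_def)
qed

end

section \<open>Reducibility\<close>

lemma ceer_refl: "ceer E \<Longrightarrow> (x, x) \<in> E"
  and ceer_sym: "ceer E \<Longrightarrow> (x, y) \<in> E \<Longrightarrow> (y, x) \<in> E"
  and ceer_trans: "ceer E \<Longrightarrow> (x, y) \<in> E \<Longrightarrow> (y, z) \<in> E \<Longrightarrow> (x, z) \<in> E"
  by (auto simp: ceer_def equiv_def refl_on_def dest: symD transD)

lemma ceer_congruence:
  assumes "ceer E" "(x, x') \<in> E" "(y, y') \<in> E"
  shows "(x, y) \<in> E \<longleftrightarrow> (x', y') \<in> E"
  using assms ceer_sym ceer_trans by metis

lemma semidec_ceer:
  assumes "ceer E" "effective f" "effective g"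
  shows "semidecidable (\<lambda>z. (f z, g z) \<in> E)"
proof -
  have "semidecidable (\<lambda>p. p \<in> E)" using assms(1) by (simp add: ceer_iff)
  then show ?thesis by (rule semidec_comp) (intro eff assms)
qed

lemma reductionI: "effective f \<Longrightarrow> (\<And>x y. (x, y) \<in> E \<longleftrightarrow> (f x, f y) \<in> R) \<Longrightarrow> reduction f E R"
  by (simp add: reduction_def effective_nat_iff)

lemma reduction_eff: "reduction f E R \<Longrightarrow> effective f"
  and reduction_iff: "reduction f E R \<Longrightarrow> (x, y) \<in> E \<longleftrightarrow> (f x, f y) \<in> R"
  by (simp_all add: reduction_def effective_nat_iff)

lemma reduction_comp:
  assumes "reduction f E R" "reduction g R S"
  shows "reduction (\<lambda>x. g (f x)) E S"
  using assms by (intro reductionI eff_comp [OF reduction_eff [OF assms(2)]])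
    (simp_all add: reduction_eff reduction_iff)

lemma reducible_trans: "E \<le>\<^sub>c R \<Longrightarrow> R \<le>\<^sub>c S \<Longrightarrow> E \<le>\<^sub>c S"
  unfolding reducible_def using reduction_comp by blast

lemma reducible_refl: "E \<le>\<^sub>c E"
  unfolding reducible_def by (rule exI [of _ "\<lambda>x. x"]) (intro reductionI eff, simp)

lemma join_iff: "(x, y) \<in> E \<oplus> R \<longleftrightarrow> even x \<and> even y \<and> (x div 2, y div 2) \<in> E \<or>
    odd x \<and> odd y \<and> (x div 2, y div 2) \<in> R"
  unfolding uniform_join_def
  by (auto dest: even_two_times_div_two [symmetric] odd_two_times_div_two_succ [symmetric])

lemma ceer_join:
  assumes "ceer E" "ceer R"
  shows "ceer (E \<oplus> R)"
  unfolding ceer_iff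
proof
  show "equiv UNIV (E \<oplus> R)"
  proof (rule equivI)
    show "refl_on UNIV (E \<oplus> R)" using assms by (auto simp: refl_on_def join_iff ceer_refl)
    show "sym (E \<oplus> R)" using assms by (auto simp: sym_def join_iff intro: ceer_sym)
    show "trans (E \<oplus> R)" using assms by (auto simp: trans_def join_iff intro: ceer_trans)
  qed simp
  have "semidecidable (\<lambda>p. (fst p, snd p) \<in> E \<oplus> R)"
    unfolding join_iff
    by (intro semidec_conj semidec_disj semidec_ceer assms; (intro semidec_eff)?; intro eff)
  then show "semidecidable (\<lambda>p. p \<in> E \<oplus> R)" by simp
qed

lemma ceer_Id_mod: "ceer (Id_mod n)"
  unfolding ceer_iff
proof
  show "equiv UNIV (Id_mod n)"
    by (rule equivI) (auto simp: Id_mod_def refl_on_def sym_def trans_def cong_def)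
  have "semidecidable (\<lambda>p. fst p mod n = snd p mod n)" by (intro semidec_eff eff)
  then show "semidecidable (\<lambda>p. p \<in> Id_mod n)"
    by (simp add: Id_mod_def cong_def case_prod_beta)
qed

lemma reduction_inl: "reduction (\<lambda>x. 2 * x) E (E \<oplus> R)"
  by (intro reductionI eff) (simp add: join_iff)

lemma reduction_inr: "reduction (\<lambda>x. 2 * x + 1) R (E \<oplus> R)"
  by (intro reductionI eff) (simp add: join_iff)

lemma reducible_I_iff: "A \<le>\<^sub>I B \<longleftrightarrow> (\<exists>n\<ge>1. A \<le>\<^sub>c B \<oplus> Id_mod n)"
proof -
  have "A \<le>\<^sub>c B \<oplus> Id_mod 1" if "A \<le>\<^sub>c B"
    using that reducible_trans reduction_inl unfolding reducible_def by metis
  then show ?thesis unfolding reducible_I_def by (metis order_refl)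
qed

lemma reducible_imp_I: "A \<le>\<^sub>c B \<Longrightarrow> A \<le>\<^sub>I B"
  by (simp add: reducible_I_def)

text \<open>A minimal covering set \<open>M\<close> consists of inequivalent points outside the range of \<open>\<rho>\<close>, so that
  \<open>X\<close> splits into a part below \<open>R\<close> and finitely many further classes.\<close>

lemma cover_reducible_I:
  assumes Y: "ceer Y" and f: "reduction f X Y" and \<rho>: "reduction \<rho> R Y"
    and "finite M" "\<And>x. (\<exists>u. (f x, \<rho> u) \<in> Y) \<or> (\<exists>a\<in>M. (f x, a) \<in> Y)"
  shows "X \<le>\<^sub>I R"
proof -
  define cover where
    "cover M \<longleftrightarrow> finite M \<and> (\<forall>x. (\<exists>u. (f x, \<rho> u) \<in> Y) \<or> (\<exists>a\<in>M. (f x, a) \<in> Y))" for M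
  have "\<exists>M. cover M" using assms(4,5) unfolding cover_def by blast
  then obtain M where M: "cover M" and least: "\<And>N. cover N \<Longrightarrow> card M \<le> card N"
    by (metis ex_has_least_nat)
  have fin: "finite M" using M by (simp add: cover_def)
  have not_cover: "\<not> cover (M - {a})" if "a \<in> M" for a
    using least [of "M - {a}"] card_Diff1_less [OF fin that] by linarith
  have distinct: "(a, b) \<notin> Y" if "a \<in> M" "b \<in> M" "a \<noteq> b" for a b
  proof
    assume ab: "(a, b) \<in> Y"
    have "cover (M - {a})"
      unfolding cover_def
    proof (intro conjI allI)
      fix x
      from M have "(\<exists>u. (f x, \<rho> u) \<in> Y) \<or> (\<exists>c\<in>M. (f x, c) \<in> Y)" by (simp add: cover_def)
      then show "(\<exists>u. (f x, \<rho> u) \<in> Y) \<or> (\<exists>c\<in>M - {a}. (f x, c) \<in> Y)"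
        using that ceer_trans [OF Y _ ab, of "f x"] by blast
    qed (use fin in simp)
    with not_cover that show False by blast
  qed
  have outside: "(\<rho> u, a) \<notin> Y" if "a \<in> M" for u a
  proof
    assume ua: "(\<rho> u, a) \<in> Y"
    have "cover (M - {a})"
      unfolding cover_def
    proof (intro conjI allI)
      fix x
      from M have "(\<exists>u. (f x, \<rho> u) \<in> Y) \<or> (\<exists>c\<in>M. (f x, c) \<in> Y)" by (simp add: cover_def)
      then show "(\<exists>u. (f x, \<rho> u) \<in> Y) \<or> (\<exists>c\<in>M - {a}. (f x, c) \<in> Y)"
        using that ceer_trans [OF Y _ ceer_sym [OF Y ua], of "f x"] by blast
    qed (use fin in simp)
    with not_cover that show False by blast
  qed
  obtain xs where xs: "set xs = M" "distinct xs" using finite_distinct_list [OF fin] by blast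
  define n where "n = length xs"
  \<comment> \<open>Codes of \<open>R \<oplus> Id_mod (Suc n)\<close> are read back into
    \<open>Y\<close>: even ones through \<open>\<rho>\<close>, odd ones as positions in
    \<open>xs\<close>.\<close>
  define \<tau> where "\<tau> c = (if even c then \<rho> (c div 2) else hd (drop (c div 2) xs))" for c
  have \<tau>_odd: "\<tau> c = xs ! (c div 2)" if "odd c" "c div 2 < n" for c
    using that by (simp add: \<tau>_def n_def hd_drop_conv_nth)
  have eff_\<tau>: "effective \<tau>"
    unfolding \<tau>_def by (intro eff eff_comp [OF reduction_eff [OF \<rho>]])
  define P where "P x c \<longleftrightarrow> (f x, \<tau> c) \<in> Y \<and> (even c \<or> c div 2 < n)" for x c
  have "semidecidable (\<lambda>z. P (fst z) (snd z))"
    unfolding P_def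
    by (intro semidec_conj semidec_ceer [OF Y] eff eff_comp [OF reduction_eff [OF f]]
        eff_comp [OF eff_\<tau>] semidec_eff)
  moreover have "\<exists>c. P x c" for x
  proof -
    from M consider u where "(f x, \<rho> u) \<in> Y" | a where "a \<in> M" "(f x, a) \<in> Y"
      unfolding cover_def by blast
    then show ?thesis
    proof cases
      case 1
      then show ?thesis by (intro exI [of _ "2 * u"]) (simp add: P_def \<tau>_def)
    next
      case 2
      then obtain i where "i < n" "a = xs ! i" using xs(1) by (metis in_set_conv_nth n_def)
      with 2 show ?thesis by (intro exI [of _ "2 * i + 1"]) (simp add: P_def \<tau>_odd)
    qed
  qed
  ultimately obtain F where F: "computable F" "\<And>x. P x (F x)" by (rule semidec_select) blast
  \<comment> \<open>Distinct positions below \<open>n\<close> are incongruent modulo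
    \<open>Suc n\<close>; the successor keeps the modulus positive when \<open>M\<close> is
    empty.\<close>
  have \<tau>: "(\<tau> c, \<tau> c') \<in> Y \<longleftrightarrow> (c, c') \<in> R \<oplus> Id_mod (Suc n)"
    if "even c \<or> c div 2 < n" "even c' \<or> c' div 2 < n" for c c'
  proof -
    have in_M: "xs ! i \<in> M" if "i < n" for i using that xs(1) n_def by force
    consider "even c" "even c'" | "even c" "odd c'" | "odd c" "even c'" | "odd c" "odd c'" by blast
    then show ?thesis
    proof cases
      case 1
      then show ?thesis by (simp add: \<tau>_def join_iff reduction_iff [OF \<rho>])
    next
      case 2
      then show ?thesis
        using that outside [OF in_M] \<tau>_odd [of c'] by (simp add: join_iff) (simp add: \<tau>_def)
    next
      case 3
      then show ?thesis
        using that outside [OF in_M] \<tau>_odd [of c] ceer_sym [OF Y]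
        by (simp add: join_iff) (metis \<tau>_def)
    next
      case 4
      then have i: "c div 2 < n" "c' div 2 < n" using that by auto
      then have "(\<tau> c, \<tau> c') \<in> Y \<longleftrightarrow> c div 2 = c' div 2"
        using 4 distinct [OF in_M in_M] xs(2) ceer_refl [OF Y]
        by (metis \<tau>_odd n_def nth_eq_iff_index_eq)
      also have "\<dots> \<longleftrightarrow> (c, c') \<in> R \<oplus> Id_mod (Suc n)"
        using 4 i by (simp add: join_iff Id_mod_def cong_def)
      finally show ?thesis .
    qed
  qed
  have "reduction F X (R \<oplus> Id_mod (Suc n))"
    unfolding reduction_def
  proof (intro conjI allI F(1))
    fix x y
    have "(x, y) \<in> X \<longleftrightarrow> (\<tau> (F x), \<tau> (F y)) \<in> Y"
      using ceer_congruence [OF Y, of "f x" "\<tau> (F x)" "f y" "\<tau> (F y)"] F(2) [of x] F(2) [of y]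
      by (simp add: P_def reduction_iff [OF f])
    then show "(x, y) \<in> X \<longleftrightarrow> (F x, F y) \<in> R \<oplus> Id_mod (Suc n)"
      using \<tau> F(2) unfolding P_def by simp
  qed
  then show ?thesis unfolding reducible_I_iff reducible_def by (intro exI [of _ "Suc n"]) auto
qed

text \<open>Composing the reductions lands in \<open>Z\<close> joined with two finite parts. Outside
  \<open>Z\<close> only \<open>n + m\<close> classes remain, and \<open>cover_reducible_I\<close>
  merges them into one finite part.\<close>

lemma reducible_I_trans:
  assumes "ceer Z" "X \<le>\<^sub>I Y" "Y \<le>\<^sub>I Z"
  shows "X \<le>\<^sub>I Z"
proof -
  obtain m n f g where f: "reduction f X (Y \<oplus> Id_mod m)" "m \<ge> 1"
    and g: "reduction g Y (Z \<oplus> Id_mod n)" "n \<ge> 1"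
    using assms(2,3) unfolding reducible_I_iff reducible_def by blast
  let ?T = "Z \<oplus> Id_mod n \<oplus> Id_mod m"
  let ?h = "\<lambda>x. if even (f x) then 2 * g (f x div 2) else f x"
  note eff' = eff_comp [OF reduction_eff [OF f(1)]] eff_comp [OF reduction_eff [OF g(1)]]
  show ?thesis
  proof (rule cover_reducible_I)
    show "ceer ?T" by (intro ceer_join ceer_Id_mod assms)
    show "reduction ?h X ?T"
      by (intro reductionI eff eff')
        (simp add: reduction_iff [OF f(1)] join_iff [of _ _ "Z \<oplus> Id_mod n"] join_iff [of _ _ Y]
          reduction_iff [OF g(1)])
    show "reduction (\<lambda>x. 2 * (2 * x)) Z ?T"
      by (rule reduction_comp [OF reduction_inl reduction_inl])
    show "finite ((\<lambda>i. 2 * (2 * i + 1)) ` {..<n} \<union> (\<lambda>i. 2 * i + 1) ` {..<m})" by simp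
    fix x
    show "(\<exists>u. (?h x, 2 * (2 * u)) \<in> ?T) \<or>
        (\<exists>a\<in>(\<lambda>i. 2 * (2 * i + 1)) ` {..<n} \<union> (\<lambda>i. 2 * i + 1) ` {..<m}. (?h x, a) \<in> ?T)"
    proof (cases "even (f x)")
      case True
      define y where "y = g (f x div 2)"
      show ?thesis
      proof (cases "even y")
        case y: True
        then have "(?h x, 2 * (2 * (y div 2))) \<in> ?T"
          using True ceer_refl [OF assms(1)] by (simp add: join_iff y_def)
        then show ?thesis by blast
      next
        case y: False
        then have "(?h x, 2 * (2 * (y div 2 mod n) + 1)) \<in> ?T"
          using True by (simp add: join_iff y_def Id_mod_def cong_def)
        moreover have "y div 2 mod n \<in> {..<n}" using g(2) by simp
        ultimately show ?thesis by blast
      qed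
    next
      case False
      then have "(?h x, 2 * (f x div 2 mod m) + 1) \<in> ?T"
        by (simp add: join_iff Id_mod_def cong_def)
      moreover have "f x div 2 mod m \<in> {..<m}" using f(2) by simp
      ultimately show ?thesis by blast
    qed
  qed
qed

text \<open>A reduction that meets the class of every \<open>\<rho> j\<close> is inverted there by
  search, and the inverse is again a reduction.\<close>

lemma onto_reducible:
  assumes Y: "ceer Y" and f: "reduction f X Y" and \<rho>: "reduction \<rho> E Y"
    and onto: "\<And>j. \<exists>x. (f x, \<rho> j) \<in> Y"
  shows "E \<le>\<^sub>c X"
proof -
  have "semidecidable (\<lambda>z. (f (snd z), \<rho> (fst z)) \<in> Y)"
    by (intro semidec_ceer [OF Y] eff_comp [OF reduction_eff [OF f]]
        eff_comp [OF reduction_eff [OF \<rho>]] eff)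
  then obtain F where F: "computable F" "\<And>j. (f (F j), \<rho> j) \<in> Y"
    by (rule semidec_select [of "\<lambda>j x. (f x, \<rho> j) \<in> Y"]) (use onto in blast)+
  have "reduction F E X"
    unfolding reduction_def
    using F ceer_congruence [OF Y F(2) F(2)] by (simp add: reduction_iff [OF f] reduction_iff [OF \<rho>])
  then show ?thesis by (auto simp: reducible_def)
qed

text \<open>The equivalence closures of all c.e. relations, side by side.\<close>

lemma universal_ceer_exists: "\<exists>U. universal_ceer U"
proof -
  obtain g :: "nat \<Rightarrow> nat \<times> nat \<times> nat" where g: "effective g" "range g = {(e, x, y). conv e x y}"
    by (rule conv_enumeration)
  let ?d = prod_decode and ?e = prod_encode
  \<comment> \<open>A triple \<open>(e, x, y)\<close> relates \<open>x\<close> to \<open>y\<close>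
    in the \<open>e\<close>-th column. The rules, chosen by the first component of \<open>n\<close>,
    are reflexivity, the base facts given by halting of \<open>e\<close> on the code of a pair,
    symmetry and transitivity.\<close>
  define F :: "nat \<times> nat \<times> nat \<Rightarrow> nat \<times> nat \<times> nat \<Rightarrow> nat \<Rightarrow> nat \<times> nat \<times> nat" where
    "F p q n = (if fst (?d n) = 0 then (fst (?d (snd (?d n))), snd (?d (snd (?d n))), snd (?d (snd (?d n))))
      else if fst (?d n) = 1 then
        (fst (g (snd (?d n))), ?d (fst (snd (g (snd (?d n))))))
      else if fst (?d n) = 2 then (fst p, snd (snd p), fst (snd p))
      else if fst p = fst q \<and> snd (snd p) = fst (snd q) then (fst p, fst (snd p), snd (snd q))
      else p)" for p q n
  have "effective (\<lambda>z. F (fst z) (fst (snd z)) (snd (snd z)))"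
    unfolding F_def by (intro eff eff_comp [OF g(1)])
  then obtain D :: "nat \<Rightarrow> nat \<times> nat \<times> nat" where D: "effective D" "D 0 = (0, 0, 0)"
    and step: "\<And>i j n. \<exists>c. D c = F (D i) (D j) n"
    and ind: "\<And>P c. P (0, 0, 0) \<Longrightarrow> (\<And>x y n. P x \<Longrightarrow> P y \<Longrightarrow> P (F x y n)) \<Longrightarrow> P (D c)"
    by (rule derivation_enumeration [of F "(0, 0, 0)"]) blast
  have D_step: "F p q n \<in> range D" if pq: "p \<in> range D" "q \<in> range D" for p q n
  proof -
    obtain i j where "p = D i" "q = D j" using pq by blast
    moreover obtain c where "D c = F (D i) (D j) n" using step by blast
    ultimately show ?thesis by (metis rangeI)
  qed
  have D_0: "D 0 \<in> range D" by blast
  have D_refl: "(e, x, x) \<in> range D" for e x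
    using D_step [OF D_0 D_0, of "?e (0, ?e (e, x))"] by (simp add: F_def)
  have D_base: "(e, x, y) \<in> range D" if "conv e (?e (x, y)) v" for e x y v
  proof -
    have "(e, ?e (x, y), v) \<in> range g" using that by (simp add: g(2))
    then obtain t where "g t = (e, ?e (x, y), v)" by (metis rangeE)
    then show ?thesis using D_step [OF D_0 D_0, of "?e (1, t)"] by (simp add: F_def)
  qed
  have D_sym: "(e, y, x) \<in> range D" if "(e, x, y) \<in> range D" for e x y
    using D_step [OF that that, of "?e (2, 0)"] by (simp add: F_def)
  have D_trans: "(e, x, z) \<in> range D" if "(e, x, y) \<in> range D" "(e, y, z) \<in> range D" for e x y z
    using D_step [OF that, of "?e (3, 0)"] by (simp add: F_def)
  define U where "U = {(a, b). fst (?d a) = fst (?d b) \<and> (fst (?d a), snd (?d a), snd (?d b)) \<in> range D}"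
  have "equiv UNIV U"
  proof (rule equivI)
    show "refl_on UNIV U" using D_refl by (auto simp: U_def refl_on_def)
    show "sym U" using D_sym by (auto simp: U_def sym_def)
    show "trans U" unfolding trans_def U_def mem_Collect_eq case_prod_conv using D_trans by metis
  qed simp
  moreover have "semidecidable (\<lambda>p. p \<in> U)"
  proof -
    have "semidecidable (\<lambda>p. fst (?d (fst p)) = fst (?d (snd p)) \<and>
        (\<exists>c. (fst (?d (fst p)), snd (?d (fst p)), snd (?d (snd p))) = D c))"
      by (intro semidec; intro semidec_eff eff eff_comp [OF D(1)])
    then show ?thesis by (simp add: U_def case_prod_beta image_def)
  qed
  ultimately have "ceer U" by (simp add: ceer_iff)
  moreover have "X \<le>\<^sub>c U" if X: "ceer X" for X
  proof -
    have "semidecidable (\<lambda>x. ?d x \<in> X)"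
      by (rule semidec_comp [of "\<lambda>p. p \<in> X"]) (use X in \<open>simp add: ceer_iff\<close>, intro eff)
    then obtain e where e: "\<And>x. ?d x \<in> X \<longleftrightarrow> (\<exists>y. conv e x y)" by (rule semidec_index) blast
    \<comment> \<open>Program \<open>e\<close> halts exactly on the codes of pairs in the ceer
      \<open>X\<close>, so the closure rules add nothing to its column.\<close>
    have "fst (D c) = e \<longrightarrow> snd (D c) \<in> X" for c
    proof (rule ind)
      show "fst (0, 0, 0) = e \<longrightarrow> snd (0, 0, 0) \<in> X" using ceer_refl [OF X] by simp
      fix p q :: "nat \<times> nat \<times> nat" and n
      assume IH: "fst p = e \<longrightarrow> snd p \<in> X" "fst q = e \<longrightarrow> snd q \<in> X"
      have g': "?d (fst (snd (g t))) \<in> X" if "fst (g t) = e" for t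
      proof -
        have "g t \<in> range g" by blast
        then have "g t \<in> {(e, x, y). conv e x y}" unfolding g(2) .
        then have "conv (fst (g t)) (fst (snd (g t))) (snd (snd (g t)))" by (simp add: case_prod_beta)
        with that e show ?thesis by blast
      qed
      obtain a b c d e' e'' where "p = (e', a, b)" "q = (e'', c, d)" by (metis prod.exhaust)
      with IH g' show "fst (F p q n) = e \<longrightarrow> snd (F p q n) \<in> X"
        unfolding F_def by (auto intro: ceer_refl [OF X] ceer_sym [OF X] ceer_trans [OF X])
    qed
    then have D_X: "(x, y) \<in> X" if "(e, x, y) \<in> range D" for x y
      using that by (metis fst_conv snd_conv rangeE)
    moreover have "(e, x, y) \<in> range D" if "(x, y) \<in> X" for x y
      using that e [of "?e (x, y)"] D_base by auto
    ultimately have "(x, y) \<in> X \<longleftrightarrow> (?e (e, x), ?e (e, y)) \<in> U" for x y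
      by (auto simp: U_def)
    then have "reduction (\<lambda>x. ?e (e, x)) X U" by (intro reductionI eff) simp
    then show ?thesis by (auto simp: reducible_def)
  qed
  ultimately show ?thesis unfolding universal_ceer_def by blast
qed

section \<open>Tight extensions\<close>

definition tight_extension :: "nat rel \<Rightarrow> nat rel \<Rightarrow> bool" where
  "tight_extension R E \<longleftrightarrow> ceer E \<and> (\<forall>x y. (2 * x, 2 * y) \<in> E \<longleftrightarrow> (x, y) \<in> R) \<and> \<not> E \<le>\<^sub>I R \<and>
    (\<forall>W. semidecidable (\<lambda>x. x \<in> W) \<longrightarrow>
      (\<exists>M. finite M \<and> (\<forall>w\<in>W. (\<exists>x. (w, 2 * x) \<in> E) \<or> (\<exists>a\<in>M. (w, a) \<in> E))) \<or>
      (\<forall>j. \<exists>w\<in>W. (w, j) \<in> E))"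

text \<open>The point is uniformity in the index. Induction appends at the end so that earlier
  indices are kept.\<close>

lemma semidec_nth:
  assumes "\<And>X. X \<in> set xs \<Longrightarrow> ceer X"
  shows "semidecidable (\<lambda>z. fst z < length xs \<and> (fst (snd z), snd (snd z)) \<in> xs ! fst z)"
  using assms
proof (induction xs rule: rev_induct)
  case Nil
  show ?case by (intro semidec_eff) (simp add: eff_const)
next
  case (snoc X xs)
  have X: "semidecidable (\<lambda>z. (fst (snd z), snd (snd z)) \<in> X)"
    by (rule semidec_ceer) (use snoc.prems in simp, (intro eff)+)
  have IH: "semidecidable (\<lambda>z. fst z < length xs \<and> (fst (snd z), snd (snd z)) \<in> xs ! fst z)"
    by (rule snoc.IH) (use snoc.prems in simp)
  have "semidecidable (\<lambda>z. (fst z < length xs \<and> (fst (snd z), snd (snd z)) \<in> xs ! fst z) \<or>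
      (fst z = length xs \<and> (fst (snd z), snd (snd z)) \<in> X))"
    by (rule semidec_disj [OF IH semidec_conj [OF semidec_eff X]]) (intro eff)
  then show ?case
    by (rule back_subst [of semidecidable]) (auto simp: nth_append fun_eq_iff)
qed

lemma tight_extension_exists:
  assumes U: "universal_ceer U" and R: "ceer R" "\<not> U \<le>\<^sub>I R"
    and "finite X" and X: "\<And>A. A \<in> X \<Longrightarrow> ceer A \<and> \<not> U \<le>\<^sub>I A"
  obtains E where "tight_extension R E" "\<And>A. A \<in> X \<Longrightarrow> \<not> E \<le>\<^sub>I A"
proof -
  let ?d = prod_decode
  have "finite (insert R X)" using assms(4) by simp
  from finite_list [OF this] obtain xs where xs: "set xs = insert R X" ..
  have xs_ceer: "\<And>A. A \<in> set xs \<Longrightarrow> ceer A" using xs X R(1) by auto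
  \<comment> \<open>\<open>k\<close> codes a position in \<open>xs\<close> and a modulus less one.
    For positions outside the list the relation is empty, and no reflexive relation reduces to
    it.\<close>
  define Q where "Q k = {(x, y). fst (?d k) < length xs \<and>
    (x, y) \<in> xs ! fst (?d k) \<oplus> Id_mod (Suc (snd (?d k)))}" for k
  have Ug: "ceer U" "equiv UNIV U" using U by (auto simp: universal_ceer_def ceer_def)
  have not_red: "\<not> U \<le>\<^sub>c Q k" for k
  proof
    assume "U \<le>\<^sub>c Q k"
    then obtain f where f: "reduction f U (Q k)" by (auto simp: reducible_def)
    have "(f 0, f 0) \<in> Q k" using reduction_iff [OF f] ceer_refl [OF Ug(1)] by blast
    then have k: "fst (?d k) < length xs" by (simp add: Q_def)
    then have "U \<le>\<^sub>c xs ! fst (?d k) \<oplus> Id_mod (Suc (snd (?d k)))"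
      using f by (auto simp: Q_def reducible_def)
    then have "U \<le>\<^sub>I xs ! fst (?d k)" by (auto simp: reducible_I_iff)
    moreover have "xs ! fst (?d k) \<in> insert R X" using k xs nth_mem by blast
    ultimately show False using X R(2) by auto
  qed
  have sem: "semidecidable (\<lambda>z. (fst (snd z), snd (snd z)) \<in> Q (fst z))"
  proof -
    have nth: "semidecidable (\<lambda>z. fst z < length xs \<and> (fst (snd z), snd (snd z)) \<in> xs ! fst z)"
      by (rule semidec_nth) (rule xs_ceer)
    have eff': "effective (\<lambda>z::nat \<times> nat \<times> nat. (fst (?d (fst z)), fst (snd z) div 2, snd (snd z) div 2))"
      by (intro eff)
    have *: "semidecidable (\<lambda>z. fst (?d (fst z)) < length xs \<and>
        (fst (snd z) div 2, snd (snd z) div 2) \<in> xs ! fst (?d (fst z)))"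
      using semidec_comp [OF nth eff'] by simp
    have "semidecidable (\<lambda>z. even (fst (snd z)) \<and> even (snd (snd z)) \<and>
         (fst (?d (fst z)) < length xs \<and> (fst (snd z) div 2, snd (snd z) div 2) \<in> xs ! fst (?d (fst z))) \<or>
        odd (fst (snd z)) \<and> odd (snd (snd z)) \<and> fst (?d (fst z)) < length xs \<and>
        (fst (snd z) div 2) mod Suc (snd (?d (fst z))) = (snd (snd z) div 2) mod Suc (snd (?d (fst z))))"
      by (intro semidec_disj semidec_conj * ; intro semidec_eff eff)
    then show ?thesis
      by (rule back_subst [of semidecidable])
        (auto simp: Q_def join_iff Id_mod_def cong_def fun_eq_iff)
  qed
  obtain g :: "nat \<Rightarrow> nat \<times> nat \<times> nat" where g: "effective g" "range g = {(e, x, y). conv e x y}"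
    by (rule conv_enumeration)
  obtain u :: "nat \<Rightarrow> nat \<times> nat" where u: "effective u" "range u = {p. p \<in> U}"
  proof (rule semidec_enumerate [of "\<lambda>p. p \<in> U" "(0, 0)" prod_decode])
    show "semidecidable (\<lambda>p. p \<in> U)" using Ug(1) by (simp add: ceer_iff)
    show "effective prod_decode" using eff_prod_decode [OF eff_ident] .
  qed (use ceer_refl [OF Ug(1)] surj_prod_decode in auto)
  obtain q :: "nat \<Rightarrow> nat \<times> nat \<times> nat" where q: "effective q"
    "range q = {z. (fst (snd z), snd (snd z)) \<in> Q (fst z)}"
  proof (rule semidec_enumerate [OF sem, of "(prod_encode (0, 0), 0, 0)" "\<lambda>n. (fst (?d n), ?d (snd (?d n)))"])
    have "length xs > 0" using xs by auto
    moreover from this have "xs ! 0 \<in> set xs" by (rule nth_mem)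
    ultimately show "(fst (snd (prod_encode (0, 0), 0, 0)), snd (snd (prod_encode (0, 0), 0, 0)))
        \<in> Q (fst (prod_encode (0, 0), 0, 0))"
      using xs_ceer ceer_refl by (simp add: Q_def join_iff)
    show "effective (\<lambda>n. (fst (?d n), ?d (snd (?d n))))" by (intro eff)
    show "surj (\<lambda>n. (fst (?d n), ?d (snd (?d n))))"
    proof (rule surjI)
      show "(fst (?d (prod_encode (fst z, prod_encode (snd z)))),
        ?d (snd (?d (prod_encode (fst z, prod_encode (snd z)))))) = z" for z by simp
    qed
  qed
  interpret priority_construction R U Q g u q
    by standard (use R Ug g u q not_red in \<open>auto simp: case_prod_beta\<close>)
  have not_I: "\<not> E \<le>\<^sub>I A" if A: "A \<in> set xs" for A
  proof
    assume "E \<le>\<^sub>I A"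
    then obtain n where n: "n \<ge> 1" "E \<le>\<^sub>c A \<oplus> Id_mod n" by (auto simp: reducible_I_iff)
    obtain i where "i < length xs" "A = xs ! i" using A by (metis in_set_conv_nth)
    then have "Q (prod_encode (i, n - 1)) = A \<oplus> Id_mod n" using n(1) by (simp add: Q_def)
    with n(2) E_not_reducible show False by metis
  qed
  have "tight_extension R E"
    unfolding tight_extension_def
  proof (intro conjI allI impI ceer_E E_iff_R not_I)
    fix W :: "nat set" assume W: "semidecidable (\<lambda>x. x \<in> W)"
    show "(\<exists>M. finite M \<and> (\<forall>w\<in>W. (\<exists>x. (w, 2 * x) \<in> E) \<or> (\<exists>a\<in>M. (w, a) \<in> E))) \<or>
      (\<forall>j. \<exists>w\<in>W. (w, j) \<in> E)" (is "?covered \<or> ?onto")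
    proof (cases ?covered)
      case False
      have "\<exists>w\<in>W. (w, j) \<in> E" for j
      proof (rule E_dichotomy [OF W])
        fix M :: "nat set" assume "finite M"
        with False show "\<exists>w\<in>W. (\<forall>x. (w, 2 * x) \<notin> E) \<and> (\<forall>a\<in>M. (w, a) \<notin> E)" by auto
      qed
      then show ?thesis by blast
    qed (rule disjI1)
  qed (simp add: xs)
  with not_I xs show ?thesis by (intro that) auto
qed

context
  fixes R E
  assumes tight: "tight_extension R E"
begin

lemma tight_ceer: "ceer E"
  and tight_iff: "(2 * x, 2 * y) \<in> E \<longleftrightarrow> (x, y) \<in> R"
  and tight_not_below: "\<not> E \<le>\<^sub>I R"
  using tight by (auto simp: tight_extension_def)

lemma tight_reduction: "reduction (\<lambda>x. 2 * x) R E"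
  by (intro reductionI eff) (simp add: tight_iff)

text \<open>The condition on c.e. sets is applied to the part \<open>W\<close> of \<open>E\<close>
  hit by \<open>f\<close>. If \<open>W\<close> is covered, the values of \<open>f\<close> outside
  the classes from \<open>R\<close> fall into finitely many classes, including those of
  \<open>Id_mod n\<close>, and \<open>cover_reducible_I\<close> applies.\<close>

lemma tight_dichotomy:
  assumes f: "reduction f X (E \<oplus> Id_mod n)" and n: "n \<ge> 1"
  shows "X \<le>\<^sub>I R \<or> (\<forall>j. \<exists>x. (f x, 2 * j) \<in> E \<oplus> Id_mod n)"
proof -
  let ?Y = "E \<oplus> Id_mod n"
  define W where "W = {w. \<exists>x. f x = 2 * w}"
  have "semidecidable (\<lambda>w. \<exists>x. f x = 2 * w)"
    by (intro semidec; intro semidec_eff eff eff_comp [OF reduction_eff [OF f]])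
  then have "semidecidable (\<lambda>x. x \<in> W)" by (simp add: W_def)
  then consider M where "finite M" "\<And>w. w \<in> W \<Longrightarrow> (\<exists>x. (w, 2 * x) \<in> E) \<or> (\<exists>a\<in>M. (w, a) \<in> E)"
    | "\<And>j. \<exists>w\<in>W. (w, j) \<in> E"
    using tight unfolding tight_extension_def by meson
  then show ?thesis
  proof cases
    case 1
    have "X \<le>\<^sub>I R"
    proof (rule cover_reducible_I [OF _ f])
      show "ceer ?Y" by (intro ceer_join ceer_Id_mod tight_ceer)
      show "reduction (\<lambda>x. 2 * (2 * x)) R ?Y"
        by (rule reduction_comp [OF tight_reduction reduction_inl])
      show "finite ((\<lambda>a. 2 * a) ` M \<union> (\<lambda>i. 2 * i + 1) ` {..<n})" using 1(1) by simp
      fix x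
      show "(\<exists>u. (f x, 2 * (2 * u)) \<in> ?Y) \<or>
          (\<exists>a\<in>(\<lambda>a. 2 * a) ` M \<union> (\<lambda>i. 2 * i + 1) ` {..<n}. (f x, a) \<in> ?Y)"
      proof (cases "even (f x)")
        case True
        then obtain w where w: "f x = 2 * w" by blast
        then have "w \<in> W" by (auto simp: W_def)
        from 1(2) [OF this] consider u where "(w, 2 * u) \<in> E" | a where "a \<in> M" "(w, a) \<in> E"
          by blast
        then show ?thesis
        proof cases
          case 1
          then have "(f x, 2 * (2 * u)) \<in> ?Y" by (simp add: join_iff w)
          then show ?thesis by blast
        next
          case 2
          then have "(f x, 2 * a) \<in> ?Y" by (simp add: join_iff w)
          with 2(1) show ?thesis by blast
        qed
      next
        case False
        then have "(f x, 2 * (f x div 2 mod n) + 1) \<in> ?Y"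
          by (simp add: join_iff Id_mod_def cong_def)
        moreover have "f x div 2 mod n \<in> {..<n}" using n by simp
        ultimately show ?thesis by blast
      qed
    qed
    then show ?thesis ..
  next
    case 2
    have "\<exists>x. (f x, 2 * j) \<in> ?Y" for j
    proof -
      obtain w x where "(w, j) \<in> E" "f x = 2 * w" using 2 [of j] by (auto simp: W_def)
      then have "(f x, 2 * j) \<in> ?Y" by (simp add: join_iff)
      then show ?thesis by blast
    qed
    then show ?thesis by blast
  qed
qed

lemma tight_below:
  assumes "X \<le>\<^sub>I E"
  shows "X \<le>\<^sub>I R \<or> E \<le>\<^sub>c X"
proof -
  obtain n f where n: "n \<ge> 1" and f: "reduction f X (E \<oplus> Id_mod n)"
    using assms by (auto simp: reducible_I_iff reducible_def)
  show ?thesis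
    using tight_dichotomy [OF f n] onto_reducible [OF _ f reduction_inl] ceer_join tight_ceer ceer_Id_mod
    by blast
qed

lemma tight_self_full: "self_full_ceer E"
  unfolding self_full_ceer_def
proof (intro conjI allI impI tight_ceer)
  fix f j assume "reduction f E E"
  \<comment> \<open>The join with \<open>Id_mod 1\<close> brings \<open>f\<close> into the shape of
    \<open>tight_dichotomy\<close>, whose first alternative would put \<open>E\<close> below
    \<open>R\<close>.\<close>
  then have "reduction (\<lambda>x. 2 * f x) E (E \<oplus> Id_mod 1)"
    by (rule reduction_comp) (rule reduction_inl)
  from tight_dichotomy [OF this] tight_not_below
  obtain x where "(2 * f x, 2 * j) \<in> E \<oplus> Id_mod 1" by auto
  then show "\<exists>k. (f k, j) \<in> E" by (auto simp: join_iff)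
qed

text \<open>Two copies of \<open>E\<close> do not fit below \<open>E\<close>, since each would meet every class.\<close>

lemma tight_not_universal:
  assumes "universal_ceer U"
  shows "\<not> U \<le>\<^sub>I E"
proof
  assume "U \<le>\<^sub>I E"
  then obtain n where n: "n \<ge> 1" "U \<le>\<^sub>c E \<oplus> Id_mod n" by (auto simp: reducible_I_iff)
  have "E \<oplus> E \<le>\<^sub>c U" using assms ceer_join [OF tight_ceer tight_ceer] by (simp add: universal_ceer_def)
  from reducible_trans [OF this n(2)]
  obtain f where f: "reduction f (E \<oplus> E) (E \<oplus> Id_mod n)" by (auto simp: reducible_def)
  have Y: "ceer (E \<oplus> Id_mod n)" by (intro ceer_join ceer_Id_mod tight_ceer)
  obtain x where x: "(f (2 * x), 2 * 0) \<in> E \<oplus> Id_mod n"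
    using tight_dichotomy [OF reduction_comp [OF reduction_inl f] n(1)] tight_not_below by blast
  obtain y where y: "(f (2 * y + 1), 2 * 0) \<in> E \<oplus> Id_mod n"
    using tight_dichotomy [OF reduction_comp [OF reduction_inr f] n(1)] tight_not_below by blast
  have "(f (2 * x), f (2 * y + 1)) \<in> E \<oplus> Id_mod n"
    using ceer_trans [OF Y x ceer_sym [OF Y y]] .
  then have "(2 * x, 2 * y + 1) \<in> E \<oplus> E" by (simp only: reduction_iff [OF f])
  then show False by (simp add: join_iff)
qed

end

section \<open>Darkness\<close>

lemma light_if_below_Id:
  assumes "infinite (UNIV // R)" "equiv UNIV R" "R \<le>\<^sub>c Id"
  shows "Id \<le>\<^sub>c R"
proof -
  obtain r where r: "reduction r R Id" using assms(3) by (auto simp: reducible_def)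
  have R_iff: "(x, y) \<in> R \<longleftrightarrow> r x = r y" for x y using reduction_iff [OF r] by simp
  have "infinite (range r)"
  proof
    assume "finite (range r)"
    moreover have "UNIV // R \<subseteq> (\<lambda>n. {y. n = r y}) ` range r"
      by (auto simp: quotient_def R_iff)
    ultimately show False using assms(1) finite_surj by blast
  qed
  then have ex: "\<exists>y. r x < r y" for x
    by (metis finite_nat_set_iff_bounded_le not_le rangeE)
  \<comment> \<open>Through \<open>r\<close>, inequivalence in \<open>R\<close> is inequality of
    numbers. Iterating the search for a larger value produces pairwise inequivalent points.\<close>
  define nxt where "nxt x = (LEAST y. r x < r y)" for x
  have nxt: "r x < r (nxt x)" for x unfolding nxt_def by (rule LeastI_ex [OF ex])
  have "computable nxt"
    unfolding nxt_def by (rule computable_Least [OF _ ex]) (intro eff eff_comp [OF reduction_eff [OF r]])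
  then have "effective (\<lambda>z. nxt (snd z))"
    unfolding effective_nat_iff [symmetric] by (rule eff_comp) (intro eff)
  then have "effective (\<lambda>n. (nxt ^^ n) 0)" by (intro eff)
  moreover have "strict_mono (\<lambda>n. r ((nxt ^^ n) 0))"
    by (simp add: strict_mono_Suc_iff nxt)
  then have "(x, y) \<in> Id \<longleftrightarrow> ((nxt ^^ x) 0, (nxt ^^ y) 0) \<in> R" for x y
    using strict_mono_eq by (auto simp: R_iff)
  ultimately show ?thesis unfolding reducible_def by (blast intro: reductionI)
qed

text \<open>At most \<open>n\<close> arguments can land in the part \<open>Id_mod n\<close>. A shift
  beyond them leaves a reduction into \<open>R\<close>.\<close>

lemma Id_reducible_I:
  assumes "Id \<le>\<^sub>I R"
  shows "Id \<le>\<^sub>c R"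
proof -
  obtain n f where n: "n \<ge> 1" and f: "reduction f Id (R \<oplus> Id_mod n)"
    using assms by (auto simp: reducible_I_iff reducible_def)
  have f_iff: "x = y \<longleftrightarrow> (f x, f y) \<in> R \<oplus> Id_mod n" for x y using reduction_iff [OF f] by simp
  have "finite {x. odd (f x)}"
  proof (rule inj_on_finite)
    show "inj_on (\<lambda>x. f x div 2 mod n) {x. odd (f x)}"
    proof (rule inj_onI)
      fix x y
      assume "x \<in> {x. odd (f x)}" "y \<in> {x. odd (f x)}" "f x div 2 mod n = f y div 2 mod n"
      then have "(f x, f y) \<in> R \<oplus> Id_mod n" by (simp add: join_iff Id_mod_def cong_def)
      then show "x = y" by (simp only: f_iff [of x y])
    qed
    show "(\<lambda>x. f x div 2 mod n) ` {x. odd (f x)} \<subseteq> {..<n}" using n by auto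
  qed simp
  then obtain N where N: "\<And>x. odd (f x) \<Longrightarrow> x < N" by (auto simp: finite_nat_set_iff_bounded)
  have even: "even (f (x + N))" for x using N [of "x + N"] by auto
  have "reduction (\<lambda>x. f (x + N) div 2) Id R"
  proof (intro reductionI eff eff_comp [OF reduction_eff [OF f]])
    fix x y
    show "(x, y) \<in> Id \<longleftrightarrow> (f (x + N) div 2, f (y + N) div 2) \<in> R"
      using f_iff [of "x + N" "y + N"] even by (simp add: join_iff)
  qed
  then show ?thesis by (auto simp: reducible_def)
qed

text \<open>By \<open>tight_below\<close>, a reduction of \<open>Id\<close> to \<open>E\<close>
  would give \<open>Id \<le>\<^sub>I R\<close> or \<open>E \<le>\<^sub>c Id\<close>. The former
  yields \<open>Id \<le>\<^sub>c R\<close>; so does the latter, as then \<open>R\<close>, with its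
  infinitely many classes, reduces to \<open>Id\<close>.\<close>

lemma tight_dark:
  assumes "tight_extension R E" "dark_ceer R"
  shows "dark_ceer E"
proof -
  note red = tight_reduction [OF assms(1)] and E = tight_ceer [OF assms(1)]
  have R: "ceer R" "infinite (UNIV // R)" "\<not> Id \<le>\<^sub>c R" "equiv UNIV R"
    using assms(2) by (auto simp: dark_ceer_def ceer_def)
  have "infinite (UNIV // E)"
  proof
    assume "finite (UNIV // E)"
    moreover have "UNIV // R \<subseteq> (\<lambda>C. {y. 2 * y \<in> C}) ` (UNIV // E)"
    proof
      fix C assume "C \<in> UNIV // R"
      then obtain x where "C = R `` {x}" by (auto simp: quotient_def)
      then have "C = {y. 2 * y \<in> E `` {2 * x}}" by (auto simp: tight_iff [OF assms(1)])
      then show "C \<in> (\<lambda>C. {y. 2 * y \<in> C}) ` (UNIV // E)" by (auto simp: quotient_def)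
    qed
    ultimately show False using R(2) finite_surj by blast
  qed
  moreover have "\<not> Id \<le>\<^sub>c E"
  proof
    assume "Id \<le>\<^sub>c E"
    then consider "Id \<le>\<^sub>I R" | "E \<le>\<^sub>c Id"
      using tight_below [OF assms(1)] reducible_imp_I by blast
    then show False
    proof cases
      case 1
      then show False using Id_reducible_I R(3) by blast
    next
      case 2
      then have "R \<le>\<^sub>c Id" using red reducible_trans unfolding reducible_def by blast
      then show False using light_if_below_Id R by blast
    qed
  qed
  ultimately show ?thesis using E by (simp add: dark_ceer_def)
qed

section \<open>Degrees\<close>

definition deg :: "nat rel \<Rightarrow> nat rel set" where "deg A = equiv_I `` {A}"

lemma mem_deg_iff: "B \<in> deg A \<longleftrightarrow> ceer A \<and> ceer B \<and> A \<le>\<^sub>I B \<and> B \<le>\<^sub>I A"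
  by (auto simp: deg_def equiv_I_def)

lemma self_mem_deg: "ceer A \<Longrightarrow> A \<in> deg A"
  by (simp add: mem_deg_iff reducible_imp_I reducible_refl)

lemma I_degrees_iff: "d \<in> I_degrees \<longleftrightarrow> (\<exists>A. ceer A \<and> d = deg A)"
  by (auto simp: I_degrees_def quotient_def deg_def)

lemma deg_eq:
  assumes "d \<in> I_degrees" "A \<in> d"
  shows "ceer A" "d = deg A"
proof -
  obtain B where B: "ceer B" "d = deg B" using assms(1) by (auto simp: I_degrees_iff)
  with assms(2) show A: "ceer A" by (simp add: mem_deg_iff)
  show "d = deg A"
    using assms(2) B A by (auto simp: mem_deg_iff intro: reducible_I_trans)
qed

lemma deg_le_iff:
  assumes "ceer A" "ceer B"
  shows "deg A \<sqsubseteq>\<^sub>I deg B \<longleftrightarrow> A \<le>\<^sub>I B"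
proof
  assume "deg A \<sqsubseteq>\<^sub>I deg B"
  then obtain A' B' where "ceer B'" "A \<le>\<^sub>I A'" "A' \<le>\<^sub>I B'" "B' \<le>\<^sub>I B"
    by (auto simp: deg_le_def mem_deg_iff)
  then show "A \<le>\<^sub>I B" using assms reducible_I_trans by meson
qed (use assms self_mem_deg in \<open>auto simp: deg_le_def\<close>)

lemma tight_strong_minimal_cover:
  assumes "ceer R" "tight_extension R E"
  shows "strong_minimal_cover I_degrees (\<sqsubseteq>\<^sub>I) (deg R) (deg E)"
proof -
  note E = tight_ceer [OF assms(2)]
  have "R \<le>\<^sub>I E"
    using tight_reduction [OF assms(2)] by (intro reducible_imp_I) (auto simp: reducible_def)
  moreover have "z \<sqsubseteq>\<^sub>I deg R" if z: "z \<in> I_degrees" "z \<sqsubseteq>\<^sub>I deg E" "\<not> deg E \<sqsubseteq>\<^sub>I z" for z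
  proof -
    obtain Z where Z: "ceer Z" "z = deg Z" using z(1) by (auto simp: I_degrees_iff)
    with z E have "Z \<le>\<^sub>I E" "\<not> E \<le>\<^sub>I Z" by (simp_all add: deg_le_iff)
    then have "Z \<le>\<^sub>I R" using tight_below [OF assms(2)] reducible_imp_I by blast
    with Z assms(1) show ?thesis by (simp add: deg_le_iff)
  qed
  ultimately show ?thesis
    using assms(1) E tight_not_below [OF assms(2)]
    by (auto simp: strong_minimal_cover_def deg_le_iff I_degrees_iff)
qed

text \<open>If \<open>E \<le>\<^sub>I F\<close> for two tight extensions, \<open>tight_below\<close>
  for \<open>F\<close> leaves only \<open>F \<le>\<^sub>c E\<close>, as \<open>E\<close> is not
  below \<open>R\<close>.\<close>

lemma tight_degrees_incomparable:
  assumes "ceer R"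
  shows "pairwise (\<lambda>a b. \<not> a \<sqsubseteq>\<^sub>I b \<and> \<not> b \<sqsubseteq>\<^sub>I a) (deg ` {E. tight_extension R E})"
proof -
  have eq: "deg E = deg F" if "tight_extension R E" "tight_extension R F" "deg E \<sqsubseteq>\<^sub>I deg F" for E F
  proof -
    note E = tight_ceer [OF that(1)] and F = tight_ceer [OF that(2)]
    have "E \<le>\<^sub>I F" using that(3) E F by (simp add: deg_le_iff)
    moreover from this have "F \<le>\<^sub>I E"
      using tight_below [OF that(2)] tight_not_below [OF that(1)] reducible_imp_I by blast
    ultimately have "F \<in> deg E" using E F by (simp add: mem_deg_iff)
    moreover have "deg E \<in> I_degrees" using E by (auto simp: I_degrees_iff)
    ultimately show ?thesis by (simp add: deg_eq(2))
  qed
  then show ?thesis unfolding pairwise_def by blast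
qed

text \<open>Given finitely many representatives of all the degrees,
  \<open>tight_extension_exists\<close> would supply one more tight extension that is below none of
  them.\<close>

lemma infinite_tight_degrees:
  assumes R: "ceer R" and not_univ: "\<not> given_by universal_ceer (deg R)"
  shows "infinite (deg ` {E. tight_extension R E})"
proof
  assume "finite (deg ` {E. tight_extension R E})"
  then obtain X where X: "X \<subseteq> {E. tight_extension R E}" "finite X"
    "deg ` {E. tight_extension R E} = deg ` X"
    by (metis finite_subset_image order_refl)
  obtain U where U: "universal_ceer U" using universal_ceer_exists by blast
  have "\<not> U \<le>\<^sub>I R"
  proof
    assume "U \<le>\<^sub>I R"
    moreover have "R \<le>\<^sub>I U" using U R by (simp add: universal_ceer_def reducible_imp_I)
    ultimately have "U \<in> deg R" using U R by (simp add: mem_deg_iff universal_ceer_def)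
    with U not_univ show False by (auto simp: given_by_def)
  qed
  then obtain E where E: "tight_extension R E" "\<And>A. A \<in> X \<Longrightarrow> \<not> E \<le>\<^sub>I A"
    by (rule tight_extension_exists [OF U R _ X(2)])
      (use X(1) U in \<open>auto intro: tight_ceer dest: tight_not_universal\<close>)
  then obtain A where A: "A \<in> X" "deg E = deg A" using X(3) by blast
  then have "E \<in> deg A" using self_mem_deg [OF tight_ceer [OF E(1)]] by simp
  with E(2) A(1) show False by (simp add: mem_deg_iff)
qed

theorem theorem7p9:
  fixes d :: "nat rel set"
  assumes "d \<in> I_degrees" and "\<not> given_by universal_ceer d"
  shows "(\<exists>C. infinite C \<and>
            (\<forall>c\<in>C. strong_minimal_cover I_degrees (\<sqsubseteq>\<^sub>I) d c \<and> given_by self_full_ceer c) \<and>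
            pairwise (\<lambda>a b. \<not> a \<sqsubseteq>\<^sub>I b \<and> \<not> b \<sqsubseteq>\<^sub>I a) C) \<and>
         (given_by dark_ceer d \<longrightarrow>
          (\<exists>C. infinite C \<and>
            (\<forall>c\<in>C. strong_minimal_cover I_degrees (\<sqsubseteq>\<^sub>I) d c \<and> given_by dark_ceer c) \<and>
            pairwise (\<lambda>a b. \<not> a \<sqsubseteq>\<^sub>I b \<and> \<not> b \<sqsubseteq>\<^sub>I a) C))"
proof (intro conjI impI)
  obtain R where R: "ceer R" "d = deg R" using assms(1) by (auto simp: I_degrees_iff)
  have "given_by self_full_ceer (deg E)" if "tight_extension R E" for E
    using that tight_self_full self_mem_deg tight_ceer unfolding given_by_def by blast
  with R assms(2) show "\<exists>C. infinite C \<and>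
      (\<forall>c\<in>C. strong_minimal_cover I_degrees (\<sqsubseteq>\<^sub>I) d c \<and> given_by self_full_ceer c) \<and>
      pairwise (\<lambda>a b. \<not> a \<sqsubseteq>\<^sub>I b \<and> \<not> b \<sqsubseteq>\<^sub>I a) C"
    by (intro exI [of _ "deg ` {E. tight_extension R E}"])
      (simp add: infinite_tight_degrees tight_degrees_incomparable tight_strong_minimal_cover)
next
  assume "given_by dark_ceer d"
  \<comment> \<open>The extensions are taken over a dark member of the degree, since
    \<open>tight_dark\<close> speaks of the ceer that is extended.\<close>
  then obtain R where "R \<in> d" and dark: "dark_ceer R" by (auto simp: given_by_def)
  then have R: "ceer R" "d = deg R" using deg_eq assms(1) by auto
  have "given_by dark_ceer (deg E)" if "tight_extension R E" for E
    using that tight_dark dark self_mem_deg tight_ceer unfolding given_by_def by blast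
  with R assms(2) show "\<exists>C. infinite C \<and>
      (\<forall>c\<in>C. strong_minimal_cover I_degrees (\<sqsubseteq>\<^sub>I) d c \<and> given_by dark_ceer c) \<and>
      pairwise (\<lambda>a b. \<not> a \<sqsubseteq>\<^sub>I b \<and> \<not> b \<sqsubseteq>\<^sub>I a) C"
    by (intro exI [of _ "deg ` {E. tight_extension R E}"])
      (simp add: infinite_tight_degrees tight_degrees_incomparable tight_strong_minimal_cover)
qed

end
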